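(* Let $A$, $A'$, $B$ and $B'$ be matrices in $\mathbb{C}^{d\times d}$. Then the Horn matrix function $G_2(A,A',B,B';x,y)$ satisfies the following infinite summation formulae for $|t|<1$: (1) $(1-t)^{-A}\,G_2\!\left(A,A',B,B';\frac{x}{1-t},y\right)=\sum_{n=0}^{\infty}\frac{(A)_n}{n!}\,G_2(A+nI,A',B,B';x,y)\,t^n$; (2) if $AA'=A'A$, $(1-t)^{-A'}\,G_2\!\left(A,A',B,B';x,\frac{y}{1-t}\right)=\sum_{n=0}^{\infty}\frac{(A')_n}{n!}\,G_2(A,A'+nI,B,B';x,y)\,t^n$; (3) if $BB'=B'B$, $G_2\!\left(A,A',B,B';x(1-t),\frac{y}{1-t}\right)(1-t)^{-B}=\sum_{n=0}^{\infty}G_2(A,A',B+nI,B';x,y)\,\frac{(B)_n}{n!}\,t^n$; (4) $G_2\!\left(A,A',B,B';\frac{x}{1-t},y(1-t)\right)(1-t)^{-B'}=\sum_{n=0}^{\infty}G_2(A,A',B,B'+nI;x,y)\,\frac{(B')_n}{n!}\,t^n$.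
   Context: $G_2(A,A',B,B';x,y)=\sum_{m,n=0}^{\infty}(A)_m(A')_n(B)_{n-m}(B')_{m-n}\frac{x^m y^n}{m!\,n!}$. Matrix Pochhammer symbol: for $M\in\mathbb{C}^{d\times d}$, $(M)_0=I$, $(M)_n=M(M+I)\cdots(M+(n-1)I)$ for $n\ge1$, and $(M)_{-n}=(-1)^n(I-M)_n^{-1}$. For $|t|<1$, $(1-t)^{-M}=\sum_{n\ge0}\frac{(M)_n}{n!}t^n$.
   Formalization: Needs |x|,|y|<1, transformed arguments in the unit disc, and existing negative-index symbols; each identity is proved for every |t|<1 where the sum over n converges (it can diverge), with convergence proved for (1) |x|+|t|<1, (2) |y|+|t|<1, and similar domains for (3), (4). *)

theory Defs
  imports "HOL-Analysis.Analysis"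
begin

text \<open>Square complex matrices of size d are elements of \<open>complex^'d^'d\<close> with \<open>d = CARD('d)\<close>;
  \<open>mat c\<close> is \<open>c I\<close> and \<open>**\<close> is the matrix product.\<close>

definition cscale :: "complex \<Rightarrow> complex^'n^'m \<Rightarrow> complex^'n^'m"  (infixr "*\<^sub>m" 75)
  where "c *\<^sub>m M = (\<chi> i j. c * M $ i $ j)"

primrec mpoch :: "complex^'d^'d \<Rightarrow> nat \<Rightarrow> complex^'d^'d" where
  "mpoch M 0 = mat 1"
| "mpoch M (Suc n) = mpoch M n ** (M + mat (of_nat n))"

text \<open>For a negative index the symbol is meaningful only if the matrix inverted below is
  invertible; \<open>matrix_inv\<close> has an unspecified value otherwise.  See \<open>mpoch_neg_defined\<close>.\<close>

definition mpoch_int :: "complex^'d^'d \<Rightarrow> int \<Rightarrow> complex^'d^'d" where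
  "mpoch_int M k =
    (if k \<ge> 0 then mpoch M (nat k)
     else (-1) ^ nat (- k) *\<^sub>m matrix_inv (mpoch (mat 1 - M) (nat (- k))))"

text \<open>All symbols of negative index exist; this says that no positive integer is an eigenvalue
  of \<open>M\<close>.\<close>

definition mpoch_neg_defined :: "complex^'d^'d \<Rightarrow> bool" where
  "mpoch_neg_defined M \<longleftrightarrow> (\<forall>n. invertible (mpoch (mat 1 - M) n))"

text \<open>The binomial series, i.e. the power of \<open>1 - t\<close> with exponent \<open>- M\<close>, for \<open>norm t < 1\<close>.\<close>

definition one_minus_mpow :: "complex \<Rightarrow> complex^'d^'d \<Rightarrow> complex^'d^'d" where
  "one_minus_mpow t M = (\<Sum>n. (t ^ n / fact n) *\<^sub>m mpoch M n)"

text \<open>The Horn matrix function, as an unordered sum over all pairs \<open>(m, n)\<close>.  When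
  \<open>mpoch_neg_defined B\<close> and \<open>mpoch_neg_defined B'\<close> hold, the double series converges absolutely
  for \<open>norm x < 1\<close> and \<open>norm y < 1\<close>.  The parameter matrices need not commute, so the order of
  the factors matters.\<close>

definition horn_G2 ::
    "complex^'d^'d \<Rightarrow> complex^'d^'d \<Rightarrow> complex^'d^'d \<Rightarrow> complex^'d^'d \<Rightarrow> complex \<Rightarrow> complex
      \<Rightarrow> complex^'d^'d" where
  "horn_G2 A A' B B' x y =
    (\<Sum>\<^sub>\<infinity>(m, n)\<in>UNIV.
      (x ^ m * y ^ n / (fact m * fact n)) *\<^sub>m
        (mpoch A m ** mpoch A' n ** mpoch_int B (int n - int m) ** mpoch_int B' (int m - int n)))"

end

theory Submission
  imports Defs "HOL-Complex_Analysis.Complex_Analysis" "HOL-Real_Asymp.Real_Asymp"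
begin

text \<open>With \<open>s\<close> in place of \<open>t\<close>, the left-hand side of each formula is a function \<open>L s\<close> that is
  holomorphic near \<open>0\<close>, and the claim is that the right-hand side is its Taylor series at \<open>0\<close>.

  To find the Taylor coefficients, let \<open>M\<close> be the parameter that is shifted.  For an integer \<open>e\<close>
  one has \<open>(1 - s)\<^bsup>-M\<^esup> (1 - s)\<^bsup>-e\<^esup> = (1 - s)\<^bsup>-(M + e)\<^esup>\<close> (\<open>one_minus_mpow_shift\<close>), so the power of \<open>1 - s\<close>
  in the \<open>(m, k)\<close> term of the Horn series turns the factor \<open>(1 - s)\<^bsup>-M\<^esup>\<close> next to that term into a
  binomial series with exponent \<open>- (M + e m k)\<close>, whose coefficients are \<open>mpoch (M + e m k) n / n!\<close>.  The
  functional equation \<open>(M)\<^bsub>j\<^esub> (M + j)\<^bsub>n\<^esub> = (M)\<^bsub>j + n\<^esub>\<close>, valid for negative \<open>j\<close> too (\<open>mpoch_int_add_nat\<close>,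
  \<open>mpoch_int_shift\<close>), identifies the outcome with \<open>mpoch M n\<close> times the corresponding coefficient of the Horn
  function with shifted parameter.  The commutation hypotheses serve to bring the shifted
  factors next to each other.

  Termwise differentiation is legitimate because the coefficients of the Horn series grow slower
  than every geometric sequence of ratio greater than \<open>1\<close> (\<open>horn_coeff_bound\<close>), so the series
  converges locally uniformly for \<open>norm x < 1\<close>, \<open>norm y < 1\<close>.

  Rearranging an absolutely convergent triple series would only reach those \<open>t\<close> for which the
  closed disc of radius \<open>norm t\<close> about \<open>0\<close> lies in the domain of \<open>L\<close>.  The formulae are asserted
  wherever both sides make sense, and this calls for function theory.  The domain of \<open>L\<close> is the
  intersection of the unit disc with an annulus about \<open>1\<close>, a \<open>crescent\<close>.  On a disc about \<open>0\<close> inside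
  it the Taylor series converges, which gives the summability claims.  If the Taylor series
  converges at \<open>t\<close>, its sum is
  holomorphic for \<open>norm s < norm t\<close> and agrees with \<open>L\<close> on the part of the crescent in this disc,
  because that part is connected; Abel's limit theorem then passes to the boundary point
  \<open>t\<close> itself (\<open>taylor_series_on_crescent\<close>).\<close>

section \<open>Scaling and multiplying complex matrices\<close>

lemma cscale_nth [simp]: "(c *\<^sub>m M) $ i $ j = c * M $ i $ j"
  by (simp add: cscale_def)

lemma norm_cscale: "norm (c *\<^sub>m M) = norm c * norm (M :: complex^'n^'m)"
proof -
  have row: "norm ((c *\<^sub>m M) $ i) = norm c * norm (M $ i)" for i
    by (simp add: norm_vec_def norm_mult L2_set_right_distrib)
  show ?thesis
    unfolding norm_vec_def[of "c *\<^sub>m M"] norm_vec_def[of M] row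
    by (simp add: L2_set_right_distrib)
qed

lemma cscale_add_right: "c *\<^sub>m (M + N) = c *\<^sub>m M + c *\<^sub>m N"
  by (simp add: vec_eq_iff algebra_simps)

lemma cscale_add_left: "(b + c) *\<^sub>m M = b *\<^sub>m M + c *\<^sub>m M"
  by (simp add: vec_eq_iff algebra_simps)

lemma cscale_cscale: "b *\<^sub>m c *\<^sub>m M = (b * c) *\<^sub>m M"
  by (simp add: vec_eq_iff)

lemma cscale_one [simp]: "1 *\<^sub>m M = M"
  by (simp add: vec_eq_iff)

lemma cscale_matrix_mult_left: "(c *\<^sub>m M) ** N = c *\<^sub>m (M ** N)"
  by (simp add: vec_eq_iff matrix_matrix_mult_def sum_distrib_left mult.assoc)

lemma cscale_matrix_mult_right: "M ** (c *\<^sub>m N) = c *\<^sub>m (M ** N)"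
  by (simp add: vec_eq_iff matrix_matrix_mult_def sum_distrib_left mult_ac)

lemma matrix_mult_mat_right: "M ** mat c = c *\<^sub>m (M :: complex^'n^'m)"
  by (simp add: vec_eq_iff matrix_matrix_mult_def mat_def if_distrib if_distribR sum.If_cases
      mult.commute cong: if_cong)

lemma matrix_mult_mat_left: "mat c ** M = c *\<^sub>m (M :: complex^'n^'m)"
  by (simp add: vec_eq_iff matrix_matrix_mult_def mat_def if_distrib if_distribR sum.If_cases
      cong: if_cong)

lemma mat_add: "mat (a + b) = mat a + (mat b :: complex^'n^'n)"
  by (simp add: vec_eq_iff mat_def)

lemma mat_diff: "mat (a - b) = mat a - (mat b :: complex^'n^'n)"
  by (simp add: vec_eq_iff mat_def)

lemma mat_zero: "mat 0 = (0 :: complex^'n^'n)"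
  by (simp add: vec_eq_iff mat_def)

lemma bounded_linear_cscale: "bounded_linear ((*\<^sub>m) c :: complex^'n^'m \<Rightarrow> complex^'n^'m)"
  by (rule bounded_linear_intro[where K = "norm c"])
     (simp_all add: cscale_add_right norm_cscale vec_eq_iff algebra_simps)

lemma matrix_mult_add_left: "(M + N) ** K = M ** K + N ** (K :: complex^'k^'m)"
  by (simp add: vec_eq_iff matrix_matrix_mult_def algebra_simps sum.distrib)

lemma matrix_mult_diff_left: "(M - N) ** K = M ** K - N ** (K :: complex^'k^'m)"
  by (simp add: vec_eq_iff matrix_matrix_mult_def algebra_simps sum_subtractf)

lemma matrix_mult_diff_right: "K ** (M - N) = K ** M - K ** (N :: complex^'k^'m)"
  by (simp add: vec_eq_iff matrix_matrix_mult_def algebra_simps sum_subtractf)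

lemma scaleR_eq_cscale: "r *\<^sub>R M = of_real r *\<^sub>m (M :: complex^'n^'m)"
  by (simp add: vec_eq_iff scaleR_conv_of_real[where 'a = complex])

text \<open>The norm on \<open>complex^'n^'m\<close> is the Euclidean norm of the entries, for which the identity matrix
  has norm greater than \<open>1\<close> in general.  The estimates below
  therefore split \<open>P ** (M + mat c)\<close> into \<open>P ** M\<close>, which costs an unspecified constant, and a scalar
  multiple of \<open>P\<close>, whose norm is known exactly.\<close>
lemma bounded_bilinear_matrix_matrix_mult:
  "bounded_bilinear ((**) :: complex^'m^'n \<Rightarrow> complex^'k^'m \<Rightarrow> complex^'k^'n)"
proof -
  have "bilinear ((**) :: complex^'m^'n \<Rightarrow> complex^'k^'m \<Rightarrow> complex^'k^'n)"
    unfolding bilinear_def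
    by (intro conjI allI linearI)
       (auto simp: matrix_mult_add_left matrix_add_ldistrib scaleR_eq_cscale
        cscale_matrix_mult_left cscale_matrix_mult_right)
  then show ?thesis by (rule bilinear_conv_bounded_bilinear[THEN iffD1])
qed

section \<open>Commuting matrices\<close>

lemma commute_shift:
  assumes "M ** N = N ** (M :: complex^'d^'d)"
  shows "(M + mat c) ** N = N ** (M + mat c)"
  using assms by (simp add: matrix_add_ldistrib matrix_mult_add_left
      matrix_mult_mat_left matrix_mult_mat_right)

lemma commute_mult:
  assumes "M ** K = K ** M" "N ** K = K ** (N :: complex^'d^'d)"
  shows "(M ** N) ** K = K ** (M ** N)"
  by (metis assms matrix_mul_assoc)

lemma matrix_inv_left_right:
  assumes "invertible (M :: complex^'d^'d)"
  shows "matrix_inv M ** M = mat 1" "M ** matrix_inv M = mat 1"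
  using someI_ex[OF assms[unfolded invertible_def]] by (simp_all add: matrix_inv_def)

lemma commute_matrix_inv:
  assumes "invertible M" "M ** N = N ** (M :: complex^'d^'d)"
  shows "matrix_inv M ** N = N ** matrix_inv M"
  by (metis assms matrix_inv_left_right matrix_mul_assoc matrix_mul_lid matrix_mul_rid)

lemma commute_mpoch:
  assumes "M ** N = N ** (M :: complex^'d^'d)"
  shows "mpoch M n ** N = N ** mpoch M n"
  by (induction n) (simp_all add: commute_mult commute_shift assms)

lemma commute_mpoch_int:
  assumes "M ** N = N ** (M :: complex^'d^'d)" "mpoch_neg_defined M"
  shows "mpoch_int M j ** N = N ** mpoch_int M j"
proof -
  have "(mat 1 - M) ** N = N ** (mat 1 - M)"
    using assms by (simp add: matrix_mult_diff_left matrix_mult_diff_right)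
  with assms(2) have "matrix_inv (mpoch (mat 1 - M) k) ** N = N ** matrix_inv (mpoch (mat 1 - M) k)" for k
    by (intro commute_matrix_inv commute_mpoch) (auto simp: mpoch_neg_defined_def)
  then show ?thesis
    by (simp add: mpoch_int_def commute_mpoch assms(1) cscale_matrix_mult_left cscale_matrix_mult_right)
qed

section \<open>The functional equation of the two-sided Pochhammer symbol\<close>

lemma mpoch_int_of_nat [simp]: "mpoch_int M (int n) = mpoch M n"
  by (simp add: mpoch_int_def)

text \<open>A product of square matrices can only be invertible if its last factor is.\<close>
lemma mpoch_neg_definedD:
  assumes "mpoch_neg_defined (M :: complex^'d^'d)"
  shows "invertible (mat 1 - M + mat (of_nat k))"
proof -
  have "invertible (mpoch (mat 1 - M) k ** (mat 1 - M + mat (of_nat k)))"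
    using assms unfolding mpoch_neg_defined_def by (metis mpoch.simps(2))
  then show ?thesis
    by (metis invertible_left_inverse invertible_right_inverse matrix_mul_assoc
        matrix_left_right_inverse)
qed

text \<open>For negative \<open>j\<close> the factor \<open>M + j\<close> is, up to sign, the last factor of the product that is
  inverted in \<open>mpoch_int M j\<close>, so multiplying by it cancels one inverse.\<close>
lemma mpoch_int_step:
  assumes "mpoch_neg_defined (M :: complex^'d^'d)"
  shows "mpoch_int M (j + 1) = mpoch_int M j ** (M + mat (of_int j))"
proof (cases "j \<ge> 0")
  case True
  then obtain n where "j = int n" by (metis zero_le_imp_eq_int)
  moreover have "int n + 1 = int (Suc n)" by simp
  ultimately show ?thesis by (simp only: mpoch_int_of_nat) simp
next
  case False
  define i where "i = nat (- j - 1)"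
  have j: "j = - int (Suc i)" using False by (simp add: i_def)
  let ?N = "mat 1 - M"
  let ?p = "mpoch ?N i" and ?f = "?N + mat (of_nat i)"
  have inv: "invertible ?p" "invertible (mpoch ?N (Suc i))"
    using assms unfolding mpoch_neg_defined_def by blast+
  have comm: "?p ** ?f = ?f ** ?p"
    by (intro commute_mpoch) (simp add: commute_shift)
  have "matrix_inv (?p ** ?f) ** ?f = matrix_inv (?p ** ?f) ** (?f ** ?p) ** matrix_inv ?p"
    by (metis inv(1) matrix_inv_left_right(2) matrix_mul_assoc matrix_mul_rid)
  also have "\<dots> = matrix_inv ?p"
    using matrix_inv_left_right(1)[OF inv(2)] by (simp flip: comm)
  finally have key: "matrix_inv (?p ** ?f) ** ?f = matrix_inv ?p" .
  have "M + mat (of_int j) = (-1) *\<^sub>m ?f"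
    by (simp add: j vec_eq_iff mat_def)
  then have "mpoch_int M j ** (M + mat (of_int j)) = (-1) ^ i *\<^sub>m matrix_inv ?p"
    by (simp add: mpoch_int_def j cscale_matrix_mult_left cscale_matrix_mult_right cscale_cscale key
        nat_add_distrib)
  also have "\<dots> = mpoch_int M (j + 1)"
  proof (cases "i = 0")
    case True
    have "matrix_inv (mat 1 :: complex^'d^'d) = mat 1"
      using matrix_inv_left_right(1)[of "mat 1 :: complex^'d^'d"] invertible_def[of "mat 1 :: complex^'d^'d"]
      by (metis matrix_mul_lid matrix_mul_rid)
    with True show ?thesis by (simp add: j mpoch_int_def)
  next
    case False
    then show ?thesis by (simp add: j mpoch_int_def)
  qed
  finally show ?thesis by simp
qed

lemma mpoch_int_add_nat:
  assumes "mpoch_neg_defined (M :: complex^'d^'d)"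
  shows "mpoch_int M (j + int n) = mpoch_int M j ** mpoch (M + mat (of_int j)) n"
proof (induction n)
  case (Suc n)
  have "mpoch_int M (j + int (Suc n)) = mpoch_int M (j + int n) ** (M + mat (of_int (j + int n)))"
    using mpoch_int_step[OF assms, of "j + int n"] by (simp add: algebra_simps)
  then show ?case
    by (simp add: Suc matrix_mul_assoc mat_add add.assoc)
qed simp

lemma mpoch_add: "mpoch M (n + k) = mpoch M n ** mpoch (M + mat (of_nat n)) k"
  by (induction k) (simp_all add: matrix_mul_assoc mat_add add.assoc)

text \<open>Both sides satisfy the same first-order recursion in \<open>j\<close> and agree at \<open>j = 0\<close>.  Going upwards
  this is multiplication by \<open>N + (i + 1)\<close>; going downwards the factor \<open>N + i\<close> has to be cancelled, and
  it is invertible because the symbols of \<open>N + 1\<close> with negative index exist.\<close>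
lemma mpoch_int_shift_one:
  assumes defN: "mpoch_neg_defined (N :: complex^'d^'d)" "mpoch_neg_defined (N + mat 1)"
  shows "mpoch_int (N + mat 1) j ** N = mpoch_int N (j + 1)"
proof (induction j rule: int_induct[where k = 0])
  case base
  show ?case by (simp add: mpoch_int_def)
next
  case (step1 i)
  have comm: "(N + mat 1 + mat (of_int i)) ** N = N ** (N + mat 1 + mat (of_int i))"
    by (rule commute_shift[OF commute_shift[OF refl]])
  have "mpoch_int (N + mat 1) (i + 1) ** N
      = mpoch_int (N + mat 1) i ** N ** (N + mat 1 + mat (of_int i))"
    by (metis comm mpoch_int_step[OF defN(2)] matrix_mul_assoc)
  also have "\<dots> = mpoch_int N (i + 1) ** (N + mat (of_int (i + 1)))"
    using step1 by (simp add: mat_add algebra_simps)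
  finally show ?case by (simp only: mpoch_int_step[OF defN(1), of "i + 1"])
next
  case (step2 i)
  let ?f = "N + mat (of_int i)"
  let ?g = "mat 1 - (N + mat 1) + mat (of_nat (nat (- i)))"
  have f: "N + mat 1 + mat (of_int (i - 1)) = ?f"
    by (simp add: mat_diff)
  have fg: "?f = (-1) *\<^sub>m ?g"
    using step2 by (simp add: vec_eq_iff mat_def)
  have "invertible ?g"
    by (rule mpoch_neg_definedD[OF defN(2)])
  then have "?f ** ((-1) *\<^sub>m matrix_inv ?g) = mat 1" "((-1) *\<^sub>m matrix_inv ?g) ** ?f = mat 1"
    unfolding fg by (simp_all add: cscale_matrix_mult_left cscale_matrix_mult_right cscale_cscale
        matrix_inv_left_right del: add_diff_cancel_right')
  then have inv: "invertible ?f" unfolding invertible_def by blast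
  have comm: "?f ** N = N ** ?f" by (rule commute_shift[OF refl])
  have "mpoch_int (N + mat 1) (i - 1) ** N ** ?f = mpoch_int (N + mat 1) (i - 1) ** ?f ** N"
    by (metis comm matrix_mul_assoc)
  also have "\<dots> = mpoch_int (N + mat 1) i ** N"
    using mpoch_int_step[OF defN(2), of "i - 1"] unfolding f by simp
  also have "\<dots> = mpoch_int N i ** ?f"
    by (simp add: step2 mpoch_int_step[OF defN(1)])
  finally have "mpoch_int (N + mat 1) (i - 1) ** N ** (?f ** matrix_inv ?f)
      = mpoch_int N i ** (?f ** matrix_inv ?f)" by (simp add: matrix_mul_assoc)
  then show ?case
    by (simp add: matrix_inv_left_right(2)[OF inv])
qed

lemma mpoch_int_shift:
  assumes "\<And>n::nat. mpoch_neg_defined (M + mat (of_nat n) :: complex^'d^'d)"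
  shows "mpoch_int (M + mat (of_nat n)) j ** mpoch M n = mpoch_int M (j + int n)"
proof (induction n arbitrary: j)
  case (Suc n)
  let ?N = "M + mat (of_nat n)"
  have SucN: "M + mat (of_nat (Suc n)) = ?N + mat 1"
    by (simp add: mat_add add_ac)
  have "mpoch M (Suc n) = ?N ** mpoch M n"
    using commute_mpoch[of M ?N n] commute_shift[of M M "of_nat n"] by simp
  then have "mpoch_int (M + mat (of_nat (Suc n))) j ** mpoch M (Suc n)
      = mpoch_int (?N + mat 1) j ** ?N ** mpoch M n"
    by (simp only: SucN matrix_mul_assoc)
  also have "mpoch_int (?N + mat 1) j ** ?N = mpoch_int ?N (j + 1)"
    using assms[of n] assms[of "Suc n"] unfolding SucN by (rule mpoch_int_shift_one)
  also have "mpoch_int ?N (j + 1) ** mpoch M n = mpoch_int M (j + int (Suc n))"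
    using Suc[of "j + 1"] by (simp add: add_ac)
  finally show ?case .
qed simp

section \<open>Growth of the coefficients\<close>

definition subexponential :: "(nat \<Rightarrow> real) \<Rightarrow> bool" where
  "subexponential u \<longleftrightarrow> (\<forall>q>1. \<exists>C\<ge>0. \<forall>n. u n \<le> C * q ^ n)"

text \<open>A sequence whose consecutive ratios are bounded by \<open>r n\<close> with \<open>r \<longlonglongrightarrow> 1\<close> is dominated by \<open>q ^ n\<close>
  from some index on; the finitely many earlier terms are absorbed in the constant.\<close>
lemma subexponential_ratio:
  assumes nonneg: "\<And>n. u n \<ge> 0"
    and rec: "eventually (\<lambda>n. u (Suc n) \<le> r n * u n) sequentially"
    and r: "r \<longlonglongrightarrow> 1"
  shows "subexponential u"
  unfolding subexponential_def
proof (intro allI impI)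
  fix q :: real assume q: "q > 1"
  have "eventually (\<lambda>n. r n < q) sequentially"
    using order_tendstoD(2)[OF r q] .
  from eventually_conj[OF rec this] obtain N where N: "\<And>n. n \<ge> N \<Longrightarrow> u (Suc n) \<le> r n * u n \<and> r n < q"
    unfolding eventually_sequentially by blast
  define C where "C = (\<Sum>n\<le>N. u n)"
  have C: "u n \<le> C" if "n \<le> N" for n
    unfolding C_def using that nonneg by (intro member_le_sum) auto
  have C0: "C \<ge> 0" unfolding C_def by (intro sum_nonneg nonneg)
  have "u n \<le> C * q ^ n" for n
  proof (cases "n \<le> N")
    case True
    have "C * 1 \<le> C * q ^ n" using q C0 by (intro mult_left_mono) auto
    then show ?thesis using C[OF True] by simp
  next
    case False
    then have "N \<le> n" by simp
    then show ?thesis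
    proof (induction n rule: dec_induct)
      case base
      have "C * 1 \<le> C * q ^ N" using q C0 by (intro mult_left_mono) auto
      then show ?case using C[of N] by simp
    next
      case (step n)
      have "u (Suc n) \<le> r n * u n" using N step by blast
      also have "\<dots> \<le> q * u n"
        using N[of n] step nonneg by (intro mult_right_mono) auto
      also have "\<dots> \<le> q * (C * q ^ n)"
        using step q by (intro mult_left_mono) auto
      finally show ?case by (simp add: mult_ac)
    qed
  qed
  with C0 show "\<exists>C\<ge>0. \<forall>n. u n \<le> C * q ^ n" by blast
qed

lemma subexponential_mult:
  assumes "subexponential u" "subexponential v" "\<And>n. u n \<ge> 0" "\<And>n. v n \<ge> 0"
  shows "subexponential (\<lambda>n. u n * v n)"
  unfolding subexponential_def
proof (intro allI impI)
  fix q :: real assume q: "q > 1"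
  then have "sqrt q > 1" by simp
  then obtain C D where C: "C \<ge> 0" "\<And>n. u n \<le> C * sqrt q ^ n"
    and D: "D \<ge> 0" "\<And>n. v n \<le> D * sqrt q ^ n"
    using assms(1,2) unfolding subexponential_def by meson
  have "u n * v n \<le> C * D * q ^ n" for n
  proof -
    have "u n * v n \<le> (C * sqrt q ^ n) * (D * sqrt q ^ n)"
      using C D assms(3,4) q by (intro mult_mono) auto
    also have "\<dots> = C * D * (sqrt q * sqrt q) ^ n" by (simp only: power_mult_distrib mult_ac)
    finally show ?thesis using q by simp
  qed
  then show "\<exists>C\<ge>0. \<forall>n. u n * v n \<le> C * q ^ n"
    using C(1) D(1) by (intro exI[of _ "C * D"]) auto
qed

text \<open>Splitting \<open>mpoch M n ** (M + n)\<close> into \<open>mpoch M n ** M\<close> and \<open>n\<close> times \<open>mpoch M n\<close> shows that one step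
  costs a factor \<open>n + O(1)\<close>, which the factorial divides out.\<close>
lemma subexponential_mpoch:
  "subexponential (\<lambda>n. norm (mpoch (M :: complex^'d^'d) n) / fact n)"
proof -
  obtain c where c: "c \<ge> 0" "\<And>(P :: complex^'d^'d) (Q :: complex^'d^'d). norm (P ** Q) \<le> norm P * norm Q * c"
    using bounded_bilinear.nonneg_bounded[OF bounded_bilinear_matrix_matrix_mult] by blast
  let ?r = "\<lambda>n. (norm M * c + real n) / (real n + 1)"
  show ?thesis
  proof (rule subexponential_ratio)
    show "eventually (\<lambda>n. norm (mpoch M (Suc n)) / fact (Suc n) \<le> ?r n * (norm (mpoch M n) / fact n)) sequentially"
    proof (rule always_eventually, rule allI)
      fix n
      have "norm (mpoch M (Suc n)) \<le> norm (mpoch M n ** M) + norm (mpoch M n ** mat (of_nat n))"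
        by (simp add: matrix_add_ldistrib norm_triangle_ineq)
      also have "\<dots> \<le> norm (mpoch M n) * norm M * c + real n * norm (mpoch M n)"
        by (intro add_mono c) (simp add: matrix_mult_mat_right norm_cscale)
      finally have "norm (mpoch M (Suc n)) \<le> (norm M * c + real n) * norm (mpoch M n)"
        by (simp add: algebra_simps)
      then have "norm (mpoch M (Suc n)) / fact (Suc n) \<le> (norm M * c + real n) * norm (mpoch M n) / fact (Suc n)"
        by (rule divide_right_mono) simp
      then show "norm (mpoch M (Suc n)) / fact (Suc n) \<le> ?r n * (norm (mpoch M n) / fact n)"
        by (simp add: add_ac)
    qed
    show "?r \<longlonglongrightarrow> 1" by real_asymp
  qed simp
qed

text \<open>Writing \<open>T n\<close> for the symbol of index \<open>- n\<close>, the recursion is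
  \<open>T n = T (Suc n) ** M - (n + 1) T (Suc n)\<close>.  As soon as \<open>n + 1\<close> exceeds the norm of multiplication by
  \<open>M\<close>, solving for \<open>T (Suc n)\<close> bounds its norm by that of \<open>T n\<close> over \<open>n + 1 - O(1)\<close>.\<close>
lemma subexponential_mpoch_neg:
  assumes "mpoch_neg_defined (M :: complex^'d^'d)"
  shows "subexponential (\<lambda>n. fact n * norm (mpoch_int M (- int n)))"
proof -
  obtain c where c: "c \<ge> 0" "\<And>(P :: complex^'d^'d) (Q :: complex^'d^'d). norm (P ** Q) \<le> norm P * norm Q * c"
    using bounded_bilinear.nonneg_bounded[OF bounded_bilinear_matrix_matrix_mult] by blast
  let ?r = "\<lambda>n. (real n + 1) / (real n + 1 - norm M * c)"
  define T where "T n = mpoch_int M (- int n)" for n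
  have T: "T n = T (Suc n) ** M - of_nat (Suc n) *\<^sub>m T (Suc n)" for n
  proof -
    have "T n = T (Suc n) ** (M + mat (of_int (- int (Suc n))))"
      using mpoch_int_step[OF assms, of "- int (Suc n)"] by (simp add: T_def)
    also have "\<dots> = T (Suc n) ** M - of_nat (Suc n) *\<^sub>m T (Suc n)"
      by (simp add: matrix_add_ldistrib matrix_mult_mat_right vec_eq_iff algebra_simps)
    finally show ?thesis .
  qed
  have "subexponential (\<lambda>n. fact n * norm (T n))"
  proof (rule subexponential_ratio)
    have "eventually (\<lambda>n. real n + 1 - norm M * c > 0) sequentially" by real_asymp
    then show "eventually (\<lambda>n. fact (Suc n) * norm (T (Suc n)) \<le> ?r n * (fact n * norm (T n))) sequentially"
    proof eventually_elim
      case (elim n)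
      have "of_nat (Suc n) *\<^sub>m T (Suc n) = T (Suc n) ** M - T n"
        using T[of n] by (simp add: algebra_simps)
      then have "(real n + 1) * norm (T (Suc n)) = norm (T (Suc n) ** M - T n)"
        by (metis norm_cscale norm_of_nat of_nat_Suc add.commute)
      also have "\<dots> \<le> norm (T (Suc n) ** M) + norm (T n)"
        by (rule norm_triangle_ineq4)
      also have "norm (T (Suc n) ** M) \<le> norm (T (Suc n)) * norm M * c"
        by (rule c)
      finally have "(real n + 1 - norm M * c) * norm (T (Suc n)) \<le> norm (T n)"
        by (simp add: algebra_simps)
      then have "norm (T (Suc n)) \<le> norm (T n) / (real n + 1 - norm M * c)"
        using elim by (simp add: field_simps)
      then have "fact (Suc n) * norm (T (Suc n)) \<le> fact (Suc n) * (norm (T n) / (real n + 1 - norm M * c))"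
        by (intro mult_left_mono) auto
      then show ?case by (simp add: mult_ac add_ac)
    qed
    show "?r \<longlonglongrightarrow> 1" by real_asymp
  qed simp
  then show ?thesis by (simp add: T_def)
qed

text \<open>The two indices are opposite, so the factorial growth of one symbol is
  compensated by the factorial decay of the other.\<close>
lemma mpoch_int_pair_bound:
  fixes B B' :: "complex^'d^'d"
  assumes "mpoch_neg_defined (B :: complex^'d^'d)" "mpoch_neg_defined B'" "q > 1"
  shows "\<exists>C\<ge>0. \<forall>j. norm (mpoch_int B j) * norm (mpoch_int B' (- j)) \<le> C * q ^ nat \<bar>j\<bar>"
proof -
  have *: "\<exists>C\<ge>0. \<forall>n. norm (mpoch_int M (int n)) * norm (mpoch_int N (- int n)) \<le> C * q ^ n"
    if "mpoch_neg_defined N" for M N :: "complex^'d^'d"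
  proof -
    have "subexponential (\<lambda>n. norm (mpoch M n) / fact n * (fact n * norm (mpoch_int N (- int n))))"
      by (rule subexponential_mult[OF subexponential_mpoch subexponential_mpoch_neg[OF that]]) auto
    then show ?thesis using assms(3) by (simp add: subexponential_def)
  qed
  obtain C where C: "C \<ge> 0" "\<And>n. norm (mpoch_int B (int n)) * norm (mpoch_int B' (- int n)) \<le> C * q ^ n"
    using *[OF assms(2)] by blast
  obtain D where D: "D \<ge> 0" "\<And>n. norm (mpoch_int B' (int n)) * norm (mpoch_int B (- int n)) \<le> D * q ^ n"
    using *[OF assms(1)] by blast
  have "norm (mpoch_int B j) * norm (mpoch_int B' (- j)) \<le> (C + D) * q ^ nat \<bar>j\<bar>" for j
  proof (cases "j \<ge> 0")
    case True
    have "norm (mpoch_int B j) * norm (mpoch_int B' (- j)) \<le> C * q ^ nat \<bar>j\<bar>"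
      using C(2)[of "nat j"] True by (simp del: mpoch_int_of_nat)
    also have "\<dots> \<le> (C + D) * q ^ nat \<bar>j\<bar>"
      using D(1) assms(3) by (intro mult_right_mono) auto
    finally show ?thesis .
  next
    case False
    have "norm (mpoch_int B j) * norm (mpoch_int B' (- j)) \<le> D * q ^ nat \<bar>j\<bar>"
      using D(2)[of "nat (- j)"] False by (simp add: mult.commute del: mpoch_int_of_nat)
    also have "\<dots> \<le> (C + D) * q ^ nat \<bar>j\<bar>"
      using C(1) assms(3) by (intro mult_right_mono) auto
    finally show ?thesis .
  qed
  with C(1) D(1) show ?thesis by (intro exI[of _ "C + D"]) auto
qed

text \<open>The coefficient of \<open>x ^ m * y ^ n\<close> in the Horn function, factorials included, so that
  it is subexponential.\<close>
definition horn_coeff ::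
  "complex^'d^'d \<Rightarrow> complex^'d^'d \<Rightarrow> complex^'d^'d \<Rightarrow> complex^'d^'d \<Rightarrow> nat \<Rightarrow> nat \<Rightarrow> complex^'d^'d"
  where "horn_coeff A A' B B' m n =
    (1 / (fact m * fact n)) *\<^sub>m
      (mpoch A m ** mpoch A' n ** mpoch_int B (int n - int m) ** mpoch_int B' (int m - int n))"

text \<open>The two factorials in the denominator take up the growth of the symbols of \<open>A\<close> and \<open>A'\<close>.
  Each of these and the pair \<open>B\<close>, \<open>B'\<close> gets the ratio \<open>sqrt q\<close>, as \<open>\<bar>n - m\<bar> \<le> m + n\<close>.\<close>
lemma horn_coeff_bound:
  assumes "mpoch_neg_defined (B :: complex^'d^'d)" "mpoch_neg_defined B'" "q > 1"
  shows "\<exists>C\<ge>0. \<forall>m n. norm (horn_coeff A A' B B' m n) \<le> C * q ^ (m + n)"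
proof -
  obtain c where c: "c \<ge> 0" "\<And>(P :: complex^'d^'d) (Q :: complex^'d^'d). norm (P ** Q) \<le> norm P * norm Q * c"
    using bounded_bilinear.nonneg_bounded[OF bounded_bilinear_matrix_matrix_mult] by blast
  define r where "r = sqrt q"
  have r: "r > 1" "r * r = q" using assms(3) by (auto simp: r_def)
  obtain C1 where C1: "C1 \<ge> 0" "\<And>n. norm (mpoch A n) / fact n \<le> C1 * r ^ n"
    using subexponential_mpoch[of A] r(1) unfolding subexponential_def by meson
  obtain C2 where C2: "C2 \<ge> 0" "\<And>n. norm (mpoch A' n) / fact n \<le> C2 * r ^ n"
    using subexponential_mpoch[of A'] r(1) unfolding subexponential_def by meson
  obtain C3 where C3: "C3 \<ge> 0" "\<And>j. norm (mpoch_int B j) * norm (mpoch_int B' (- j)) \<le> C3 * r ^ nat \<bar>j\<bar>"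
    using mpoch_int_pair_bound[OF assms(1,2) r(1)] by blast
  have "norm (horn_coeff A A' B B' m n) \<le> C1 * C2 * C3 * c ^ 3 * q ^ (m + n)" for m n
  proof -
    let ?j = "int n - int m"
    let ?a = "norm (mpoch A m)" and ?a' = "norm (mpoch A' n)"
    let ?b = "norm (mpoch_int B ?j)" and ?b' = "norm (mpoch_int B' (- ?j))"
    have bb: "?b * ?b' \<le> C3 * r ^ nat \<bar>?j\<bar>" by (rule C3(2))
    have "norm (mpoch A m ** mpoch A' n ** mpoch_int B ?j ** mpoch_int B' (- ?j))
        \<le> norm (mpoch A m ** mpoch A' n ** mpoch_int B ?j) * ?b' * c" by (rule c)
    also have "\<dots> \<le> (norm (mpoch A m ** mpoch A' n) * ?b * c) * ?b' * c"
      by (intro mult_right_mono c) auto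
    also have "\<dots> \<le> ((?a * ?a' * c) * ?b * c) * ?b' * c"
      by (intro mult_right_mono c) auto
    finally have "norm (mpoch A m ** mpoch A' n ** mpoch_int B ?j ** mpoch_int B' (- ?j))
        \<le> (?a * ?a') * (?b * ?b') * c ^ 3" by (simp add: power3_eq_cube mult_ac)
    then have "norm (horn_coeff A A' B B' m n) \<le> (?a * ?a') * (?b * ?b') * c ^ 3 / (fact m * fact n)"
      by (simp add: horn_coeff_def norm_cscale norm_divide norm_mult divide_right_mono)
    also have "\<dots> = (?a / fact m) * (?a' / fact n) * (?b * ?b') * c ^ 3" by simp
    also have "\<dots> \<le> (C1 * r ^ m) * (C2 * r ^ n) * (C3 * r ^ nat \<bar>?j\<bar>) * c ^ 3"
      by (intro mult_right_mono[OF mult_mono[OF mult_mono[OF C1(2) C2(2)] bb]])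
         (use C1(1) C2(1) C3(1) r c(1) in auto)
    also have "\<dots> \<le> (C1 * r ^ m) * (C2 * r ^ n) * (C3 * r ^ (m + n)) * c ^ 3"
      using C1 C2 C3 r c(1)
      by (intro mult_right_mono mult_left_mono power_increasing mult_nonneg_nonneg) auto
    also have "\<dots> = C1 * C2 * C3 * c ^ 3 * (r * r) ^ (m + n)"
      by (simp only: power_add power_mult_distrib mult_ac)
    finally show ?thesis by (simp add: r(2))
  qed
  with C1(1) C2(1) C3(1) c(1) show ?thesis
    by (intro exI[of _ "C1 * C2 * C3 * c ^ 3"]) auto
qed

section \<open>Power series and series of holomorphic functions\<close>

text \<open>Abel's limit theorem.  With \<open>b n\<close> the error of the \<open>n\<close>-th partial sum, summation by parts gives
  \<open>(\<Sum>n. a n * r ^ n) - S = (1 - r) * (\<Sum>n. b n * r ^ n)\<close>.  A tail on which \<open>b\<close> is small contributes little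
  because \<open>(1 - r) * (\<Sum>n. r ^ n) = 1\<close>, and the finitely many other terms vanish with \<open>1 - r\<close>.\<close>
lemma abel_limit:
  fixes a :: "nat \<Rightarrow> complex"
  assumes "a sums S"
  shows "((\<lambda>r::real. \<Sum>n. a n * of_real r ^ n) \<longlongrightarrow> S) (at_left 1)"
proof -
  define b where "b n = (\<Sum>k\<le>n. a k) - S" for n
  have b0: "b \<longlonglongrightarrow> 0"
    using assms unfolding sums_def_le b_def by (rule LIM_zero)
  then obtain K where K: "K > 0" "\<And>n. norm (b n) \<le> K"
    using convergent_imp_Bseq[OF convergentI[OF b0]] unfolding Bseq_def by blast
  have smb: "summable (\<lambda>n. norm (b n * of_real r ^ n))" if "0 < r" "r < 1" for r :: real
  proof (rule summable_comparison_test)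
    show "\<exists>N. \<forall>n\<ge>N. norm (norm (b n * of_real r ^ n)) \<le> K * r ^ n"
      using that K by (auto simp: norm_mult norm_power intro!: mult_right_mono)
    show "summable (\<lambda>n. K * r ^ n)"
      using that by (intro summable_mult summable_geometric) auto
  qed
  have key: "(\<Sum>n. a n * of_real r ^ n) - S = (1 - of_real r) * (\<Sum>n. b n * of_real r ^ n)"
    if r: "0 < r" "r < 1" for r :: real
  proof -
    have sb: "(\<lambda>n. b n * of_real r ^ n) sums (\<Sum>n. b n * of_real r ^ n)" (is "_ sums ?B")
      using summable_norm_cancel[OF smb[OF r]] by (rule summable_sums)
    \<comment> \<open>\<open>a n\<close> is the difference of consecutive errors, where the error before the first term is \<open>- S\<close>.\<close>
    have "(\<lambda>n. case n of 0 \<Rightarrow> - S | Suc k \<Rightarrow> of_real r * (b k * of_real r ^ k)) sums (of_real r * ?B + - S)"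
      using sums_Suc_iff[of "\<lambda>n. case n of 0 \<Rightarrow> - S | Suc k \<Rightarrow> of_real r * (b k * of_real r ^ k)"]
        sums_mult[OF sb, of "of_real r"] by simp
    from sums_diff[OF sb this]
    have "(\<lambda>n. a n * of_real r ^ n) sums (?B - (of_real r * ?B + - S))"
    proof (rule sums_cong[THEN iffD1, rotated])
      fix n
      show "b n * of_real r ^ n - (case n of 0 \<Rightarrow> - S | Suc k \<Rightarrow> of_real r * (b k * of_real r ^ k))
          = a n * of_real r ^ n"
        by (cases n) (simp_all add: b_def algebra_simps)
    qed
    then show ?thesis by (simp add: sums_iff algebra_simps)
  qed
  have "((\<lambda>r::real. (\<Sum>n. a n * of_real r ^ n) - S) \<longlongrightarrow> 0) (at_left 1)"
  proof (rule tendstoI)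
    fix e :: real assume e: "e > 0"
    then obtain N where N: "\<And>n. n \<ge> N \<Longrightarrow> norm (b n) < e / 2"
      using LIMSEQ_D[OF b0, of "e / 2"] by auto
    define D where "D = (\<Sum>n<N. norm (b n))"
    have "((\<lambda>r::real. (1 - r) * D) \<longlongrightarrow> (1 - 1) * D) (at_left 1)"
      by (intro tendsto_intros)
    then have "eventually (\<lambda>r::real. (1 - r) * D < e / 2) (at_left 1)"
      by (rule order_tendstoD) (use e in simp)
    moreover have "eventually (\<lambda>r::real. r \<in> {0<..<1}) (at_left 1)"
      by (rule eventually_at_leftI[of 0]) auto
    ultimately show "eventually (\<lambda>r. dist ((\<Sum>n. a n * of_real r ^ n) - S) 0 < e) (at_left 1)"
    proof eventually_elim
      case (elim r)
      then have r: "0 < r" "r < 1" by auto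
      have fin: "(\<lambda>n. if n < N then norm (b n) else 0) sums D"
        using sums_If_finite_set[of "{..<N}" "\<lambda>n. norm (b n)"] by (simp add: D_def)
      have geo: "(\<lambda>n. e / 2 * r ^ n) sums (e / 2 * (1 / (1 - r)))"
        using r by (intro sums_mult geometric_sums) auto
      have le: "norm (b n * of_real r ^ n) \<le> e / 2 * r ^ n + (if n < N then norm (b n) else 0)" for n
      proof (cases "n < N")
        case True
        have "norm (b n) * r ^ n \<le> norm (b n) * 1"
          using r by (intro mult_left_mono power_le_one) auto
        moreover have "0 \<le> e / 2 * r ^ n" using e r by simp
        ultimately have "norm (b n) * r ^ n \<le> e / 2 * r ^ n + norm (b n)" by linarith
        then show ?thesis using r True by (simp add: norm_mult norm_power)
      next
        case False
        have "norm (b n) * r ^ n \<le> e / 2 * r ^ n"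
          using N[of n] False r by (intro mult_right_mono) auto
        then show ?thesis using r False by (simp add: norm_mult norm_power)
      qed
      have "norm (\<Sum>n. b n * of_real r ^ n) \<le> (\<Sum>n. norm (b n * of_real r ^ n))"
        by (rule summable_norm[OF smb[OF r]])
      also have "\<dots> \<le> e / 2 * (1 / (1 - r)) + D"
        using suminf_le[OF le smb[OF r]] sums_add[OF geo fin] by (simp add: sums_iff)
      finally have "(1 - r) * norm (\<Sum>n. b n * of_real r ^ n) \<le> (1 - r) * (e / 2 * (1 / (1 - r)) + D)"
        using r by (intro mult_left_mono) auto
      also have "\<dots> = e / 2 + (1 - r) * D" using r by (simp add: field_simps)
      also have "\<dots> < e" using elim by linarith
      finally have "(1 - r) * norm (\<Sum>n. b n * of_real r ^ n) < e" .
      moreover have "norm (1 - complex_of_real r) = 1 - r"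
        using r by (metis abs_of_pos diff_gt_0_iff_gt norm_of_real of_real_1 of_real_diff)
      ultimately show ?case
        by (simp add: key[OF r] norm_mult)
    qed
  qed
  then show ?thesis by (rule LIM_zero_cancel)
qed

text \<open>The points of a disc about \<open>0\<close> in an open annulus about \<open>1\<close> with radii \<open>\<alpha>\<close> and \<open>1 / \<beta>\<close>.  The outer
  bound is written as a product so that \<open>\<beta> = 0\<close> removes it.\<close>
definition crescent :: "real \<Rightarrow> real \<Rightarrow> real \<Rightarrow> complex set" where
  "crescent \<rho> \<alpha> \<beta> = {s. norm s < \<rho> \<and> \<alpha> < norm (1 - s) \<and> \<beta> * norm (1 - s) < 1}"

lemma open_crescent: "open (crescent \<rho> \<alpha> \<beta>)"
  unfolding crescent_def by (intro open_Collect_conj open_Collect_less continuous_intros)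

lemma zero_in_crescent: "\<rho> > 0 \<Longrightarrow> \<alpha> < 1 \<Longrightarrow> \<beta> < 1 \<Longrightarrow> 0 \<in> crescent \<rho> \<alpha> \<beta>"
  by (simp add: crescent_def)

text \<open>A point \<open>s\<close> is joined to \<open>0\<close> in two moves, neither of which increases the distance to \<open>0\<close>: a
  rotation about \<open>1\<close> onto the real axis, which keeps \<open>norm (1 - s)\<close>, and then the
  segment to \<open>0\<close>, on which \<open>norm (1 - s)\<close> moves monotonically to \<open>1\<close> and so stays between the bounds.\<close>
lemma connected_crescent:
  assumes "\<alpha> < 1" "0 \<le> \<beta>" "\<beta> < 1"
  shows "connected (crescent \<rho> \<alpha> \<beta>)"
proof -
  have *: "connected_component (crescent \<rho> \<alpha> \<beta>) 0 s" if s: "s \<in> crescent \<rho> \<alpha> \<beta>" for s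
  proof -
    define d \<phi> where "d = norm (1 - s)" and "\<phi> = Arg (1 - s)"
    have s_eq: "s = 1 - of_real d * cis \<phi>"
      unfolding d_def \<phi>_def using rcis_cmod_Arg[of "1 - s"] by (simp add: rcis_def)
    have norm_eq: "(norm (1 - of_real d * cis x))\<^sup>2 = 1 - 2 * d * cos x + d\<^sup>2" for x
    proof -
      have "(norm (1 - of_real d * cis x))\<^sup>2 = (1 - d * cos x)\<^sup>2 + (d * sin x)\<^sup>2"
        by (simp add: cmod_power2)
      also have "\<dots> = 1 - 2 * d * cos x + d\<^sup>2 * ((sin x)\<^sup>2 + (cos x)\<^sup>2)"
        by algebra
      finally show ?thesis by simp
    qed
    have d: "d \<ge> 0" "\<alpha> < d" "\<beta> * d < 1" "norm s < \<rho>"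
      using s by (auto simp: d_def crescent_def)
    \<comment> \<open>\<open>arc\<close> rotates about \<open>1\<close> from the real point \<open>1 - d\<close> to \<open>s\<close>; \<open>ray\<close> leads from \<open>1 - d\<close> to \<open>0\<close>.\<close>
    define arc where "arc u = 1 - of_real d * cis (u * \<phi>)" for u :: real
    define ray where "ray u = 1 - complex_of_real ((1 - u) * d + u)" for u :: real
    have arc_in: "arc u \<in> crescent \<rho> \<alpha> \<beta>" if u: "u \<in> {0..1}" for u
    proof -
      have "\<bar>\<phi>\<bar> \<le> pi" unfolding \<phi>_def using Arg_bounded[of "1 - s"] by auto
      moreover have "\<bar>u * \<phi>\<bar> \<le> 1 * \<bar>\<phi>\<bar>"
        using u unfolding abs_mult by (intro mult_right_mono) auto
      ultimately have "cos \<bar>\<phi>\<bar> \<le> cos \<bar>u * \<phi>\<bar>"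
        by (intro cos_monotone_0_pi_le) auto
      then have "d * cos \<phi> \<le> d * cos (u * \<phi>)"
        using d by (intro mult_left_mono) auto
      then have "(norm (arc u))\<^sup>2 \<le> (norm s)\<^sup>2"
        by (subst s_eq) (simp add: arc_def norm_eq)
      then have "norm (arc u) \<le> norm s" by (rule power2_le_imp_le) simp
      then show ?thesis using d by (simp add: arc_def crescent_def norm_mult)
    qed
    have ray_in: "ray u \<in> crescent \<rho> \<alpha> \<beta>" if u: "u \<in> {0..1}" for u
    proof -
      have e: "(1 - u) * d + u \<ge> 0" using u d by simp
      have "1 - ((1 - u) * d + u) = (1 - u) * (1 - d)" by (simp add: algebra_simps)
      then have "norm (ray u) = \<bar>(1 - u) * (1 - d)\<bar>"
        unfolding ray_def by (metis norm_of_real of_real_1 of_real_diff)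
      also have "\<dots> \<le> 1 * \<bar>1 - d\<bar>"
        using u unfolding abs_mult by (intro mult_right_mono) auto
      also have "\<dots> \<le> norm s"
        using norm_triangle_ineq3[of 1 "1 - s"] by (simp add: d_def)
      finally have "norm (ray u) < \<rho>" using d by simp
      moreover have "norm (1 - ray u) = (1 - u) * d + u"
        unfolding ray_def using e by (simp only: diff_diff_eq2 add_diff_cancel_left' norm_of_real abs_of_nonneg)
      moreover have "\<alpha> < (1 - u) * d + u"
        using convex_bound_lt[of "- d" "- \<alpha>" "- 1" "1 - u" u] d assms u by simp
      moreover have "\<beta> * ((1 - u) * d + u) < 1"
        using convex_bound_lt[of "\<beta> * d" 1 \<beta> "1 - u" u] d assms u by (simp add: algebra_simps)
      ultimately show ?thesis by (simp add: crescent_def)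
    qed
    have "connected_component (crescent \<rho> \<alpha> \<beta>) (arc 0) (arc 1)"
      unfolding connected_component_def
    proof (intro exI conjI)
      show "connected (arc ` {0..1})"
        unfolding arc_def cis_conv_exp by (intro connected_continuous_image continuous_intros connected_Icc)
    qed (use arc_in in auto)
    moreover have "connected_component (crescent \<rho> \<alpha> \<beta>) (ray 1) (ray 0)"
      unfolding connected_component_def
    proof (intro exI conjI)
      show "connected (ray ` {0..1})"
        unfolding ray_def by (intro connected_continuous_image continuous_intros connected_Icc)
    qed (use ray_in in auto)
    moreover have "arc 0 = ray 0" "arc 1 = s" "ray 1 = 0"
      by (simp_all add: arc_def ray_def s_eq[symmetric])
    ultimately show ?thesis by (metis connected_component_trans)
  qed
  show ?thesis
    unfolding connected_iff_connected_component
    using * connected_component_trans connected_component_sym by blast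
qed

lemma higher_deriv_power_series_0:
  assumes "r > 0" "\<And>z. norm z < r \<Longrightarrow> (\<lambda>n. a n * z ^ n) sums (f z :: complex)"
  shows "f holomorphic_on ball 0 r" "(deriv ^^ n) f 0 = fact n * a n"
proof -
  show "f holomorphic_on ball 0 r"
    by (rule power_series_holomorphic[where a = a]) (use assms in auto)
  have "f has_fps_expansion Abs_fps a"
    unfolding has_fps_expansion_def
  proof
    have "fps_conv_radius (Abs_fps a) \<ge> r"
      unfolding fps_conv_radius_def
    proof (rule conv_radius_geI_ex)
      fix r' :: real assume "0 < r'" "ereal r' < ereal r"
      then show "\<exists>z. norm z = r' \<and> summable (\<lambda>n. fps_nth (Abs_fps a) n * z ^ n)"
        using assms(2)[of "of_real r'"] by (intro exI[of _ "of_real r'"]) (auto simp: sums_iff)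
    qed
    then show "0 < fps_conv_radius (Abs_fps a)" using assms(1)
      by (metis ereal_less(2) less_le_trans)
    have "eventually (\<lambda>z. z \<in> ball 0 r) (nhds (0::complex))"
      using assms(1) by (intro eventually_nhds_in_open) auto
    then show "eventually (\<lambda>z. eval_fps (Abs_fps a) z = f z) (nhds 0)"
      by eventually_elim (use assms(2) in \<open>auto simp: eval_fps_def sums_iff\<close>)
  qed
  from fps_nth_fps_expansion[OF this, of n] show "(deriv ^^ n) f 0 = fact n * a n"
    by (simp add: field_simps)
qed

text \<open>The first claim is the identity theorem on the part of the crescent with \<open>norm s < norm t\<close>, followed
  by a radial limit at \<open>t\<close>.  The part has to be connected for this, whereas the
  segment from \<open>0\<close> to \<open>t\<close> may leave the crescent.  In the second claim the hypotheses say that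
  the crescent contains a disc about \<open>0\<close> of radius larger than \<open>norm t\<close>.\<close>
lemma taylor_series_on_crescent:
  assumes hol: "L holomorphic_on crescent 1 \<alpha> \<beta>"
    and \<alpha>: "0 \<le> \<alpha>" "\<alpha> < 1" and \<beta>: "0 \<le> \<beta>" "\<beta> < 1"
    and t: "t \<in> crescent 1 \<alpha> \<beta>"
    and a: "\<And>n. (deriv ^^ n) L 0 = fact n * a n"
  shows "summable (\<lambda>n. a n * t ^ n) \<Longrightarrow> (\<lambda>n. a n * t ^ n) sums L t"
    and "\<alpha> + norm t < 1 \<Longrightarrow> \<beta> * (1 + norm t) < 1 \<Longrightarrow> summable (\<lambda>n. a n * t ^ n)"
proof -
  assume sm: "summable (\<lambda>n. a n * t ^ n)"
  show "(\<lambda>n. a n * t ^ n) sums L t"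
  proof (cases "t = 0")
    case True
    then show ?thesis using a[of 0] powser_sums_zero[of a] by simp
  next
    case False
    define F where "F s = (\<Sum>n. a n * s ^ n)" for s
    let ?V = "crescent (norm t) \<alpha> \<beta>"
    have sums: "(\<lambda>n. a n * s ^ n) sums F s" if "norm s < norm t" for s
      unfolding F_def using powser_inside[OF sm that] by (rule summable_sums)
    have "norm t > 0" using False by simp
    note F = higher_deriv_power_series_0[OF this sums, simplified]
    have V_sub: "?V \<subseteq> crescent 1 \<alpha> \<beta>" "?V \<subseteq> ball 0 (norm t)"
      using t by (auto simp: crescent_def)
    have V0: "0 \<in> ?V" using False \<alpha> \<beta> by (intro zero_in_crescent) auto
    have LV: "L holomorphic_on ?V" and FV: "F holomorphic_on ?V"
      using hol F(1) V_sub holomorphic_on_subset by blast+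
    have eq: "L s = F s" if "s \<in> ?V" for s
    proof -
      have "(\<lambda>z. L z - F z) s = 0"
      proof (rule holomorphic_fun_eq_0_on_connected[where S = ?V and z = 0 and w = s
            and f = "\<lambda>z. L z - F z"])
        show "(\<lambda>z. L z - F z) holomorphic_on ?V" by (intro holomorphic_intros LV FV)
        show "connected ?V" using \<alpha> \<beta> by (intro connected_crescent)
        show "(deriv ^^ n) (\<lambda>z. L z - F z) 0 = 0" for n
          using higher_deriv_diff[OF LV FV open_crescent V0] a[of n] F(2)[of n] by simp
      qed (use that V0 in \<open>auto simp: open_crescent\<close>)
      then show ?thesis by simp
    qed
    have lim: "((\<lambda>r::real. of_real r * t) \<longlongrightarrow> of_real 1 * t) (at_left 1)"
      by (intro tendsto_intros)
    have "isCont L t"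
      using hol t open_crescent holomorphic_on_imp_continuous_on continuous_on_eq_continuous_at by blast
    with lim have limL: "((\<lambda>r::real. L (of_real r * t)) \<longlongrightarrow> L t) (at_left 1)"
      using isCont_tendsto_compose by fastforce
    have limF: "((\<lambda>r::real. F (of_real r * t)) \<longlongrightarrow> (\<Sum>n. a n * t ^ n)) (at_left 1)"
      using abel_limit[OF summable_sums[OF sm]] by (simp add: F_def power_mult_distrib mult_ac)
    have "eventually (\<lambda>r::real. L (of_real r * t) = F (of_real r * t)) (at_left 1)"
    proof -
      have "eventually (\<lambda>r::real. of_real r * t \<in> crescent 1 \<alpha> \<beta>) (at_left 1)"
        using topological_tendstoD[OF lim open_crescent] t by simp
      moreover have "eventually (\<lambda>r::real. r \<in> {0<..<1}) (at_left 1)"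
        by (rule eventually_at_leftI[of 0]) auto
      ultimately show ?thesis
      proof eventually_elim
        case (elim r)
        then have "norm (of_real r * t) < norm t"
          using False by (simp add: norm_mult)
        with elim(1) show ?case by (intro eq) (auto simp: crescent_def)
      qed
    qed
    with limL have "((\<lambda>r::real. F (of_real r * t)) \<longlongrightarrow> L t) (at_left 1)"
      by (rule Lim_transform_eventually)
    with limF have "(\<Sum>n. a n * t ^ n) = L t"
      by (rule tendsto_unique[OF trivial_limit_at_left_real])
    with sm show ?thesis by (simp add: sums_iff)
  qed
next
  assume *: "\<alpha> + norm t < 1" "\<beta> * (1 + norm t) < 1"
  \<comment> \<open>The distance from \<open>0\<close> to the complement of the annulus.\<close>
  define R where "R = (if \<beta> = 0 then 1 - \<alpha> else min (1 - \<alpha>) (1 / \<beta> - 1))"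
  have R: "norm t < R" "\<alpha> + R \<le> 1" "\<beta> * (1 + R) \<le> 1"
    using * \<beta> by (auto simp: R_def field_simps min_def)
  have "ball 0 R \<subseteq> crescent 1 \<alpha> \<beta>"
  proof
    fix s :: complex assume "s \<in> ball 0 R"
    then have s: "norm s < R" by simp
    have "\<alpha> < norm (1 - s)"
      using norm_triangle_ineq2[of 1 s] s R by simp
    moreover have "\<beta> * norm (1 - s) < 1"
    proof (cases "\<beta> = 0")
      case False
      have "\<beta> * norm (1 - s) < \<beta> * (1 + R)"
        using norm_triangle_ineq4[of 1 s] s False \<beta> by (intro mult_strict_left_mono) auto
      with R show ?thesis by simp
    qed simp
    ultimately show "s \<in> crescent 1 \<alpha> \<beta>" using s R \<alpha> by (simp add: crescent_def)
  qed
  then have "L holomorphic_on ball 0 R" using hol holomorphic_on_subset by blast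
  from holomorphic_power_series[OF this, of t]
  show "summable (\<lambda>n. a n * t ^ n)" using R(1) by (simp add: a sums_iff)
qed

text \<open>By the Weierstrass M-test the finite partial sums converge locally uniformly, and locally
  uniform convergence of holomorphic functions passes to all derivatives.\<close>
lemma infsum_holomorphic:
  fixes \<phi> :: "'i \<Rightarrow> complex \<Rightarrow> complex"
  assumes U: "open U" and hol: "\<And>i. \<phi> i holomorphic_on U"
    and dom: "\<And>s. s \<in> U \<Longrightarrow> \<exists>r>0. \<exists>M. M summable_on UNIV \<and> (\<forall>i. \<forall>z\<in>ball s r. norm (\<phi> i z) \<le> M i)"
  shows "(\<lambda>s. \<Sum>\<^sub>\<infinity>i. \<phi> i s) holomorphic_on U"
    and "s \<in> U \<Longrightarrow> ((\<lambda>i. (deriv ^^ n) (\<phi> i) s) has_sum (deriv ^^ n) (\<lambda>s. \<Sum>\<^sub>\<infinity>i. \<phi> i s) s) UNIV"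
proof -
  let ?g = "\<lambda>s. \<Sum>\<^sub>\<infinity>i. \<phi> i s" and ?F = "finite_subsets_at_top (UNIV :: 'i set)"
  have unif: "\<exists>r>0. cball s r \<subseteq> U \<and> uniform_limit (cball s r) (\<lambda>I z. \<Sum>i\<in>I. \<phi> i z) ?g ?F"
    if s: "s \<in> U" for s
  proof -
    obtain r M where r: "r > 0" "M summable_on UNIV" "\<And>i z. z \<in> ball s r \<Longrightarrow> norm (\<phi> i z) \<le> M i"
      using dom[OF s] by blast
    obtain r' where r': "r' > 0" "cball s r' \<subseteq> U" using U s open_contains_cball by blast
    let ?r = "min (r / 2) r'"
    have sub: "cball s ?r \<subseteq> ball s r" "cball s ?r \<subseteq> U" using r r' by auto
    have "uniform_limit (cball s ?r) (\<lambda>I z. \<Sum>i\<in>I. \<phi> i z) ?g ?F"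
      by (rule Weierstrass_m_test_general[OF _ r(2)]) (use r(3) sub in blast)
    then show ?thesis using r r' sub by (intro exI[of _ ?r]) auto
  qed
  have ghol: "?g holomorphic_on ball s r"
    if "cball s r \<subseteq> U" "uniform_limit (cball s r) (\<lambda>I z. \<Sum>i\<in>I. \<phi> i z) ?g ?F" for s r
  proof (rule holomorphic_uniform_limit[OF _ that(2)])
    have "(\<lambda>z. \<Sum>i\<in>I. \<phi> i z) holomorphic_on cball s r" for I
      using hol that(1) holomorphic_on_subset by (intro holomorphic_on_sum) blast
    then show "eventually (\<lambda>I. continuous_on (cball s r) (\<lambda>z. \<Sum>i\<in>I. \<phi> i z) \<and>
        (\<lambda>z. \<Sum>i\<in>I. \<phi> i z) holomorphic_on ball s r) ?F"
      by (intro always_eventually allI conjI)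
         (auto intro: holomorphic_on_imp_continuous_on holomorphic_on_subset[OF _ ball_subset_cball])
  qed auto
  show "?g holomorphic_on U"
    unfolding holomorphic_on_open[OF U]
  proof
    fix s assume "s \<in> U"
    then obtain r where "r > 0" "?g holomorphic_on ball s r" using unif ghol by blast
    then show "\<exists>f'. (?g has_field_derivative f') (at s)"
      by (metis centre_in_ball holomorphic_on_open open_ball)
  qed
  assume "s \<in> U"
  then obtain r where r: "r > 0" "cball s r \<subseteq> U"
      "uniform_limit (cball s r) (\<lambda>I z. \<Sum>i\<in>I. \<phi> i z) ?g ?F" using unif by blast
  have holr: "\<phi> i holomorphic_on ball s r" for i
    using hol r(2) ball_subset_cball holomorphic_on_subset by (metis subset_trans)
  have deriv_sum: "(deriv ^^ n) (\<lambda>z. \<Sum>i\<in>I. \<phi> i z) s = (\<Sum>i\<in>I. (deriv ^^ n) (\<phi> i) s)"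
    if "finite I" for I
    using that
  proof (induction I)
    case (insert i I)
    have "(deriv ^^ n) (\<lambda>z. \<phi> i z + (\<Sum>i\<in>I. \<phi> i z)) s
        = (deriv ^^ n) (\<phi> i) s + (deriv ^^ n) (\<lambda>z. \<Sum>i\<in>I. \<phi> i z) s"
      using r(1) by (intro higher_deriv_add[of _ "ball s r"] holomorphic_intros holr) auto
    with insert show ?case by simp
  qed simp
  have "((\<lambda>I. (deriv ^^ n) (\<lambda>z. \<Sum>i\<in>I. \<phi> i z) s) \<longlongrightarrow> (deriv ^^ n) ?g s) ?F"
    using r(1) by (intro higher_deriv_complex_uniform_limit[where A = "ball s r"]
        uniform_limit_on_subset[OF r(3)] always_eventually allI holomorphic_intros holr) auto
  then show "((\<lambda>i. (deriv ^^ n) (\<phi> i) s) has_sum (deriv ^^ n) ?g s) UNIV"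
    unfolding has_sum_def
    by (rule tendsto_cong[THEN iffD1, rotated])
       (auto simp: deriv_sum intro!: eventually_finite_subsets_at_top_weakI)
qed

section \<open>Entrywise sums and geometric double series\<close>

lemma entry_bounded_linear: "bounded_linear (\<lambda>M :: complex^'n^'m. M $ i $ j)"
  by (rule bounded_linear_compose[OF bounded_linear_vec_nth bounded_linear_vec_nth])

lemma sums_entrywise:
  fixes f :: "nat \<Rightarrow> complex^'n^'m"
  shows "f sums S \<longleftrightarrow> (\<forall>i j. (\<lambda>n. f n $ i $ j) sums (S $ i $ j))"
proof
  assume "f sums S"
  then show "\<forall>i j. (\<lambda>n. f n $ i $ j) sums (S $ i $ j)"
    using bounded_linear.sums[OF entry_bounded_linear] by blast
next
  assume *: "\<forall>i j. (\<lambda>n. f n $ i $ j) sums (S $ i $ j)"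
  then show "f sums S"
    unfolding sums_def by (intro vec_tendstoI) (simp add: sum_component)
qed

lemma summable_entrywise:
  fixes f :: "nat \<Rightarrow> complex^'n^'m"
  shows "summable f \<longleftrightarrow> (\<forall>i j. summable (\<lambda>n. f n $ i $ j))"
proof
  assume "summable f"
  then show "\<forall>i j. summable (\<lambda>n. f n $ i $ j)"
    using bounded_linear.summable[OF entry_bounded_linear] by blast
next
  assume *: "\<forall>i j. summable (\<lambda>n. f n $ i $ j)"
  have "f sums (\<chi> i j. \<Sum>n. f n $ i $ j)"
    unfolding sums_entrywise using * by (simp add: summable_sums)
  then show "summable f" by (rule sums_summable)
qed

lemma summable_on_geometric_pairs:
  fixes z :: real
  assumes "0 \<le> z" "z < 1"
  shows "(\<lambda>(m, n). C * z ^ (m + n)) summable_on (UNIV :: (nat \<times> nat) set)"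
proof -
  have geo: "(\<lambda>n. z ^ n) summable_on UNIV"
    using assms by (subst summable_on_UNIV_nonneg_real_iff) (auto intro: summable_geometric)
  have "(\<lambda>(m, n). z ^ m * z ^ n) summable_on (UNIV \<times> UNIV :: (nat \<times> nat) set)"
  proof (rule summable_on_SigmaI)
    show "((\<lambda>n. case (m, n) of (m, n) \<Rightarrow> z ^ m * z ^ n) has_sum (z ^ m * (\<Sum>\<^sub>\<infinity>n. z ^ n))) UNIV"
      for m :: nat
      using has_sum_cmult_right[OF has_sum_infsum[OF geo]] by simp
    show "(\<lambda>m. z ^ m * (\<Sum>\<^sub>\<infinity>n. z ^ n)) summable_on UNIV"
      by (rule summable_on_cmult_left[OF geo])
  qed (use assms in auto)
  from summable_on_cmult_right[OF this, of C] show ?thesis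
    by (simp add: case_prod_unfold power_add)
qed

text \<open>Room for a subexponential factor in a geometric series.\<close>
lemma subunit_slack:
  fixes h :: real
  assumes "0 \<le> h" "h < 1"
  obtains q where "q > 1" "q * h < 1"
proof (rule that[of "2 / (1 + h)"])
  show "2 / (1 + h) > 1" "2 / (1 + h) * h < 1" using assms by (auto simp: field_simps)
qed

section \<open>The binomial series\<close>

lemma summable_norm_binomial:
  assumes "0 \<le> \<rho>" "\<rho> < 1"
  shows "summable (\<lambda>n. \<rho> ^ n / fact n * norm (mpoch (M :: complex^'d^'d) n))"
proof -
  obtain q where q: "q > 1" "q * \<rho> < 1" using subunit_slack[OF assms] .
  obtain C where C: "C \<ge> 0" "\<And>n. norm (mpoch M n) / fact n \<le> C * q ^ n"
    using subexponential_mpoch[of M] q(1) unfolding subexponential_def by meson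
  show ?thesis
  proof (rule summable_comparison_test)
    show "summable (\<lambda>n. C * (q * \<rho>) ^ n)"
      using q assms by (intro summable_mult summable_geometric) auto
    have "\<rho> ^ n / fact n * norm (mpoch M n) \<le> C * (q * \<rho>) ^ n" for n
    proof -
      have "\<rho> ^ n * (norm (mpoch M n) / fact n) \<le> \<rho> ^ n * (C * q ^ n)"
        using assms C by (intro mult_left_mono) auto
      then show ?thesis by (simp add: power_mult_distrib mult_ac)
    qed
    then show "\<exists>N. \<forall>n\<ge>N. norm (\<rho> ^ n / fact n * norm (mpoch M n)) \<le> C * (q * \<rho>) ^ n"
      using assms by simp
  qed
qed

lemma binomial_series_norm:
  assumes "norm s \<le> \<rho>" "\<rho> < 1"
  shows "summable (\<lambda>n. norm ((s ^ n / fact n) *\<^sub>m mpoch (M :: complex^'d^'d) n))"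
    and "norm (one_minus_mpow s M) \<le> (\<Sum>n. \<rho> ^ n / fact n * norm (mpoch M n))"
proof -
  have \<rho>: "0 \<le> \<rho>" using assms(1) norm_ge_zero[of s] by linarith
  note sm = summable_norm_binomial[OF \<rho> assms(2), of M]
  have le: "norm ((s ^ n / fact n) *\<^sub>m mpoch M n) \<le> \<rho> ^ n / fact n * norm (mpoch M n)" for n
    using power_mono[OF assms(1), of n]
    by (auto simp: norm_cscale norm_divide norm_power intro!: mult_right_mono divide_right_mono)
  show *: "summable (\<lambda>n. norm ((s ^ n / fact n) *\<^sub>m mpoch M n))"
    by (rule summable_comparison_test[OF _ sm]) (use le in auto)
  show "norm (one_minus_mpow s M) \<le> (\<Sum>n. \<rho> ^ n / fact n * norm (mpoch M n))"
    unfolding one_minus_mpow_def using summable_norm[OF *] suminf_le[OF le * sm] by linarith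
qed

lemma one_minus_mpow_sums:
  assumes "norm s < 1"
  shows "(\<lambda>n. (s ^ n / fact n) *\<^sub>m mpoch M n) sums one_minus_mpow s (M :: complex^'d^'d)"
  unfolding one_minus_mpow_def
  using binomial_series_norm(1)[OF order_refl assms] by (intro summable_sums) (rule summable_norm_cancel)

lemma mpoch_Suc_left: "mpoch M (Suc n) = M ** mpoch (M + mat 1) n"
  using mpoch_add[of M 1 n] by (simp add: mat_zero)

text \<open>Comparing coefficients of \<open>s ^ Suc n\<close>, this is
  \<open>mpoch M (Suc n) = mpoch (M + 1) (Suc n) - Suc n * mpoch (M + 1) n\<close>: both terms on the right have
  the factor \<open>mpoch (M + 1) n\<close>, and the difference of the cofactors is \<open>M\<close>.\<close>
lemma one_minus_mpow_step:
  assumes s: "norm s < 1"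
  shows "one_minus_mpow s M = (1 - s) *\<^sub>m one_minus_mpow s (M + mat 1 :: complex^'d^'d)"
proof -
  let ?g = "\<lambda>n. (s ^ n / fact n) *\<^sub>m mpoch (M + mat 1) n"
  let ?f = "\<lambda>n. (s ^ n / fact n) *\<^sub>m mpoch M n"
  let ?S = "one_minus_mpow s (M + mat 1)"
  have g: "?g sums ?S" by (rule one_minus_mpow_sums[OF s])
  then have "?g sums (?S - mat 1 + ?g 0)" by simp
  then have "(\<lambda>n. ?g (Suc n)) sums (?S - mat 1)"
    by (rule sums_Suc_iff[THEN iffD2])
  moreover have "(\<lambda>n. s *\<^sub>m ?g n) sums (s *\<^sub>m ?S)"
    by (rule bounded_linear.sums[OF bounded_linear_cscale g])
  ultimately have "(\<lambda>n. ?g (Suc n) - s *\<^sub>m ?g n) sums (?S - mat 1 - s *\<^sub>m ?S)"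
    by (intro sums_diff)
  moreover have "?g (Suc n) - s *\<^sub>m ?g n = ?f (Suc n)" for n
  proof -
    have comm: "mpoch (M + mat 1) n ** M = M ** mpoch (M + mat 1) n"
      by (intro commute_mpoch commute_shift refl)
    have "mpoch (M + mat 1) (Suc n) = mpoch (M + mat 1) n ** M + of_nat (Suc n) *\<^sub>m mpoch (M + mat 1) n"
      by (simp add: matrix_add_ldistrib matrix_mult_mat_right cscale_add_left)
    then have eq: "mpoch M (Suc n) = mpoch (M + mat 1) (Suc n) - of_nat (Suc n) *\<^sub>m mpoch (M + mat 1) n"
      by (simp only: mpoch_Suc_left comm) simp
    have c: "s ^ Suc n / fact (Suc n) * of_nat (Suc n) = s * (s ^ n / fact n)"
      by (simp add: field_simps del: of_nat_Suc)
    have "?f (Suc n) = ?g (Suc n) - (s ^ Suc n / fact (Suc n) * of_nat (Suc n)) *\<^sub>m mpoch (M + mat 1) n"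
      unfolding eq by (simp only: vec_eq_iff cscale_nth vector_minus_component right_diff_distrib mult.assoc simp_thms)
    then show ?thesis unfolding c by (simp add: cscale_cscale)
  qed
  ultimately have "(\<lambda>n. ?f (Suc n)) sums (?S - mat 1 - s *\<^sub>m ?S)"
    by (simp only:)
  then have "?f sums (?S - mat 1 - s *\<^sub>m ?S + ?f 0)"
    by (rule sums_Suc_iff[THEN iffD1])
  moreover have "?S - mat 1 - s *\<^sub>m ?S + ?f 0 = (1 - s) *\<^sub>m ?S"
    by (simp add: vec_eq_iff algebra_simps)
  ultimately show ?thesis
    using sums_unique2[OF one_minus_mpow_sums[OF s]] by metis
qed

lemma one_minus_mpow_shift:
  assumes s: "norm s < 1"
  shows "one_minus_mpow s (M + mat (of_int e)) = (1 - s) powi (- e) *\<^sub>m one_minus_mpow s (M :: complex^'d^'d)"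
proof -
  have nz: "1 - s \<noteq> 0" using s by auto
  show ?thesis
  proof (induction e rule: int_induct[where k = 0])
    case base
    show ?case by (simp add: mat_zero)
  next
    case (step1 i)
    have "(1 - s) powi (- i) *\<^sub>m one_minus_mpow s M
        = (1 - s) *\<^sub>m one_minus_mpow s (M + mat (of_int (i + 1)))"
      using one_minus_mpow_step[OF s, of "M + mat (of_int i)"] step1
      by (simp add: mat_add add.assoc)
    then have "one_minus_mpow s (M + mat (of_int (i + 1)))
        = (1 / (1 - s)) *\<^sub>m (1 - s) powi (- i) *\<^sub>m one_minus_mpow s M"
      using nz by (simp add: cscale_cscale)
    also have "\<dots> = (1 - s) powi (- (i + 1)) *\<^sub>m one_minus_mpow s M"
      using nz power_int_add_1[of "1 - s" "- (i + 1)"] by (simp add: cscale_cscale)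
    finally show ?case .
  next
    case (step2 i)
    have "one_minus_mpow s (M + mat (of_int (i - 1)))
        = (1 - s) *\<^sub>m (1 - s) powi (- i) *\<^sub>m one_minus_mpow s M"
      using one_minus_mpow_step[OF s, of "M + mat (of_int (i - 1))"] step2
      by (simp add: mat_diff)
    also have "\<dots> = (1 - s) powi (- (i - 1)) *\<^sub>m one_minus_mpow s M"
      using nz power_int_add_1[of "1 - s" "- i"] by (simp add: cscale_cscale mult.commute)
    finally show ?case .
  qed
qed

section \<open>Generating functions of double matrix power series\<close>

lemma double_power_series_summable:
  fixes K :: "nat \<Rightarrow> nat \<Rightarrow> complex^'d^'d"
  assumes K: "\<And>q. q > 1 \<Longrightarrow> \<exists>C\<ge>0. \<forall>m n. norm (K m n) \<le> C * q ^ (m + n)"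
    and "norm X < 1" "norm Y < 1"
  shows "(\<lambda>(m, n). (X ^ m * Y ^ n) *\<^sub>m K m n) summable_on UNIV"
proof -
  define h where "h = max (norm X) (norm Y)"
  have h: "0 \<le> h" "h < 1" "norm X \<le> h" "norm Y \<le> h" using assms by (auto simp: h_def le_max_iff_disj)
  obtain q where q: "q > 1" "q * h < 1" using subunit_slack[OF h(1,2)] .
  obtain C where C: "C \<ge> 0" "\<And>m n. norm (K m n) \<le> C * q ^ (m + n)" using K[OF q(1)] by blast
  have "(\<lambda>(m, n). C * (q * h) ^ (m + n)) summable_on UNIV"
    using q h by (intro summable_on_geometric_pairs) auto
  then have "(\<lambda>i. norm (case i of (m, n) \<Rightarrow> (X ^ m * Y ^ n) *\<^sub>m K m n)) summable_on UNIV"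
  proof (rule summable_on_comparison_test)
    fix i :: "nat \<times> nat"
    obtain m n where i: "i = (m, n)" by force
    have "norm X ^ m * norm Y ^ n * norm (K m n) \<le> h ^ m * h ^ n * (C * q ^ (m + n))"
      using h C by (intro mult_mono power_mono) auto
    then show "norm (case i of (m, n) \<Rightarrow> (X ^ m * Y ^ n) *\<^sub>m K m n)
        \<le> (case i of (m, n) \<Rightarrow> C * (q * h) ^ (m + n))"
      by (simp add: i norm_cscale norm_mult norm_power power_mult_distrib power_add mult_ac)
  qed auto
  then show ?thesis by (rule abs_summable_summable)
qed

lemma horn_G2_eq_coeff:
  "horn_G2 A A' B B' x y = (\<Sum>\<^sub>\<infinity>(m, n)\<in>UNIV. (x ^ m * y ^ n) *\<^sub>m horn_coeff A A' B B' m n)"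
  by (simp add: horn_G2_def horn_coeff_def cscale_cscale)

lemma horn_G2_has_sum:
  assumes "mpoch_neg_defined B" "mpoch_neg_defined B'" "norm x < 1" "norm y < 1"
  shows "((\<lambda>(m, n). (x ^ m * y ^ n) *\<^sub>m horn_coeff A A' B B' m n) has_sum horn_G2 A A' B B' x y) UNIV"
  unfolding horn_G2_eq_coeff
  by (intro has_sum_infsum double_power_series_summable horn_coeff_bound assms)

text \<open>The binomial factor stands on the left in two of the formulae and on the right in the other two.
  The locale covers \<open>P ** Q\<close> and \<open>Q ** P\<close> at once; as \<open>bounded_bilinear\<close> only speaks about real scalars,
  complex linearity is required separately.\<close>
locale complex_matrix_pairing = bounded_bilinear pair
  for pair :: "complex^'d^'d \<Rightarrow> complex^'d^'d \<Rightarrow> complex^'d^'d" +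
  assumes cscale_left: "pair (c *\<^sub>m P) Q = c *\<^sub>m pair P Q"
    and cscale_right: "pair P (c *\<^sub>m Q) = c *\<^sub>m pair P Q"
begin

lemma entry_right: "bounded_linear (\<lambda>Q. pair P Q $ i $ j)"
  by (rule bounded_linear_compose[OF entry_bounded_linear bounded_linear_right])

lemma binomial_entry_sums:
  assumes "norm s < 1"
  shows "(\<lambda>n. pair (mpoch M n) Q $ i $ j / fact n * s ^ n) sums (pair (one_minus_mpow s M) Q $ i $ j)"
  using bounded_linear.sums[OF bounded_linear_compose[OF entry_bounded_linear bounded_linear_left]
      one_minus_mpow_sums[OF assms, of M], of Q i j]
  by (simp add: cscale_left mult.commute)

text \<open>On the crescent the arguments \<open>X s\<close> and \<open>Y s\<close> stay in the unit disc, where \<open>G\<close> converges.  By \<open>XY\<close>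
  the \<open>(m, k)\<close> term of the double series, multiplied by the binomial series of \<open>M\<close>, is
  \<open>x ^ m * y ^ k\<close> times the binomial series of \<open>M + e m k\<close>; hence its Taylor coefficients at \<open>0\<close> are
  those that are summed in \<open>H\<close>.  Everything is done entrywise, where complex function theory applies.\<close>
lemma binomial_generating_function:
  fixes K :: "nat \<Rightarrow> nat \<Rightarrow> complex^'d^'d" and e :: "nat \<Rightarrow> nat \<Rightarrow> int"
    and X Y :: "complex \<Rightarrow> complex" and H :: "nat \<Rightarrow> complex^'d^'d"
  defines "G \<equiv> \<lambda>x y. \<Sum>\<^sub>\<infinity>(m, k)\<in>UNIV. (x ^ m * y ^ k) *\<^sub>m K m k"
  assumes K: "\<And>q. q > 1 \<Longrightarrow> \<exists>C\<ge>0. \<forall>m n. norm (K m n) \<le> C * q ^ (m + n)"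
    and \<alpha>: "0 \<le> \<alpha>" "\<alpha> < 1" and \<beta>: "0 \<le> \<beta>" "\<beta> < 1"
    and X: "continuous_on (crescent 1 \<alpha> \<beta>) X" "\<And>s. s \<in> crescent 1 \<alpha> \<beta> \<Longrightarrow> norm (X s) < 1"
    and Y: "continuous_on (crescent 1 \<alpha> \<beta>) Y" "\<And>s. s \<in> crescent 1 \<alpha> \<beta> \<Longrightarrow> norm (Y s) < 1"
    and XY: "\<And>s m k. s \<in> crescent 1 \<alpha> \<beta> \<Longrightarrow> X s ^ m * Y s ^ k = x ^ m * y ^ k * (1 - s) powi (- e m k)"
    and H: "\<And>n. ((\<lambda>(m, k). (x ^ m * y ^ k) *\<^sub>m pair (mpoch (M + mat (of_int (e m k))) n) (K m k)) has_sum H n) UNIV"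
    and t: "t \<in> crescent 1 \<alpha> \<beta>"
  shows "summable (\<lambda>n. (t ^ n / fact n) *\<^sub>m H n) \<Longrightarrow>
      (\<lambda>n. (t ^ n / fact n) *\<^sub>m H n) sums pair (one_minus_mpow t M) (G (X t) (Y t))"
    and "\<alpha> + norm t < 1 \<Longrightarrow> \<beta> * (1 + norm t) < 1 \<Longrightarrow> summable (\<lambda>n. (t ^ n / fact n) *\<^sub>m H n)"
proof -
  let ?U = "crescent 1 \<alpha> \<beta>"
  define L where "L p r s = pair (one_minus_mpow s M) (G (X s) (Y s)) $ p $ r" for p r s
  define a where "a p r n = H n $ p $ r / fact n" for p r n
  have U1: "norm s < 1" if "s \<in> ?U" for s using that by (simp add: crescent_def)
  have L: "L p r holomorphic_on ?U \<and> (\<forall>n. (deriv ^^ n) (L p r) 0 = fact n * a p r n)" for p r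
  proof -
    \<comment> \<open>The terms are defined by the shifted binomial series, which makes sense on the whole unit disc;
      on the crescent they are the terms of the double series (\<open>\<phi>_eq\<close>).\<close>
    define \<phi> :: "nat \<times> nat \<Rightarrow> complex \<Rightarrow> complex" where
      "\<phi> = (\<lambda>(m, k) s. x ^ m * y ^ k * pair (one_minus_mpow s (M + mat (of_int (e m k)))) (K m k) $ p $ r)"
    have \<phi>_pow: "\<phi> (m, k) holomorphic_on ball 0 1 \<and>
        (\<forall>n. (deriv ^^ n) (\<phi> (m, k)) 0 = x ^ m * y ^ k * pair (mpoch (M + mat (of_int (e m k))) n) (K m k) $ p $ r)"
      for m k
    proof -
      let ?c = "\<lambda>n. x ^ m * y ^ k * (pair (mpoch (M + mat (of_int (e m k))) n) (K m k) $ p $ r / fact n)"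
      have "(\<lambda>n. ?c n * s ^ n) sums \<phi> (m, k) s" if "norm s < 1" for s
        using sums_mult[OF binomial_entry_sums[OF that], of "x ^ m * y ^ k"]
        by (simp add: \<phi>_def mult.assoc)
      from higher_deriv_power_series_0[OF zero_less_one this] show ?thesis by simp
    qed
    have \<phi>_eq: "\<phi> (m, k) s = X s ^ m * Y s ^ k * pair (one_minus_mpow s M) (K m k) $ p $ r"
      if "s \<in> ?U" for m k s
      by (simp add: \<phi>_def one_minus_mpow_shift[OF U1[OF that]] XY[OF that] cscale_left)
    have L_eq: "L p r s = (\<Sum>\<^sub>\<infinity>i. \<phi> i s)" if s: "s \<in> ?U" for s
    proof -
      have "((\<lambda>(m, k). (X s ^ m * Y s ^ k) *\<^sub>m K m k) has_sum G (X s) (Y s)) UNIV"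
        unfolding G_def by (intro has_sum_infsum double_power_series_summable K X Y s)
      from has_sum_bounded_linear[OF entry_right this]
      have "((\<lambda>i. \<phi> i s) has_sum L p r s) UNIV"
        unfolding L_def
        by (rule has_sum_cong[THEN iffD1, rotated])
           (use s in \<open>auto simp: \<phi>_eq cscale_right\<close>)
      then show ?thesis by (simp add: infsumI)
    qed
    have dom: "\<exists>\<delta>>0. \<exists>D. D summable_on UNIV \<and> (\<forall>i. \<forall>z\<in>ball s \<delta>. norm (\<phi> i z) \<le> D i)"
      if s: "s \<in> ?U" for s
    proof -
      obtain c where c: "c \<ge> 0" "\<And>P Q. norm (pair P Q) \<le> norm P * norm Q * c"
        using nonneg_bounded by blast
      \<comment> \<open>Radii strictly between the values at \<open>s\<close> and \<open>1\<close>; near \<open>s\<close> they bound \<open>norm z\<close> and both arguments.\<close>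
      define \<rho> where "\<rho> = (norm s + 1) / 2"
      define h where "h = (max (norm (X s)) (norm (Y s)) + 1) / 2"
      have \<rho>: "norm s < \<rho>" "\<rho> < 1" using U1[OF s] by (auto simp: \<rho>_def)
      have h: "norm (X s) < h" "norm (Y s) < h" "h < 1"
        using X(2)[OF s] Y(2)[OF s] by (auto simp: h_def)
      have h0: "0 \<le> h" using h(1) norm_ge_zero[of "X s"] by linarith
      obtain q where q: "q > 1" "q * h < 1" using subunit_slack[OF h0 h(3)] .
      obtain C where C: "C \<ge> 0" "\<And>m n. norm (K m n) \<le> C * q ^ (m + n)" using K[OF q(1)] by blast
      define B where "B = (\<Sum>n. \<rho> ^ n / fact n * norm (mpoch M n))"
      have "isCont X s" "isCont Y s"
        using X(1) Y(1) s open_crescent continuous_on_eq_continuous_at by blast+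
      then have "((\<lambda>z. norm (X z)) \<longlongrightarrow> norm (X s)) (nhds s)" "((\<lambda>z. norm (Y z)) \<longlongrightarrow> norm (Y s)) (nhds s)"
        by (auto intro!: tendsto_norm simp: continuous_at tendsto_at_iff_tendsto_nhds)
      then have "eventually (\<lambda>z. norm (X z) < h) (nhds s)" "eventually (\<lambda>z. norm (Y z) < h) (nhds s)"
        using h order_tendstoD(2) by blast+
      moreover have "eventually (\<lambda>z. z \<in> ?U \<inter> ball 0 \<rho>) (nhds s)"
        using s \<rho>(1) open_crescent by (intro eventually_nhds_in_open) auto
      ultimately have "eventually (\<lambda>z. norm (X z) < h \<and> norm (Y z) < h \<and> z \<in> ?U \<inter> ball 0 \<rho>) (nhds s)"
        by eventually_elim auto
      then obtain \<delta> where \<delta>: "\<delta> > 0"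
        "\<And>z. z \<in> ball s \<delta> \<Longrightarrow> norm (X z) < h \<and> norm (Y z) < h \<and> z \<in> ?U \<inter> ball 0 \<rho>"
        unfolding eventually_nhds_metric by (auto simp: dist_commute)
      have "norm (\<phi> (m, k) z) \<le> B * C * c * (q * h) ^ (m + k)" if z: "z \<in> ball s \<delta>" for m k z
      proof -
        have zz: "norm (X z) \<le> h" "norm (Y z) \<le> h" "z \<in> ?U" "norm z \<le> \<rho>"
          using \<delta>(2)[OF z] by auto
        have P: "norm (one_minus_mpow z M) \<le> B"
          unfolding B_def by (rule binomial_series_norm(2)[OF zz(4) \<rho>(2)])
        then have B0: "0 \<le> B" using norm_ge_zero order_trans by blast
        have "norm (pair (one_minus_mpow z M) (K m k) $ p $ r) \<le> norm (pair (one_minus_mpow z M) (K m k))"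
          by (rule order_trans[OF Finite_Cartesian_Product.norm_nth_le
              Finite_Cartesian_Product.norm_nth_le])
        also have "\<dots> \<le> norm (one_minus_mpow z M) * norm (K m k) * c" by (rule c)
        also have "\<dots> \<le> B * (C * q ^ (m + k)) * c"
          by (intro mult_right_mono mult_mono P C(2) c(1) B0 norm_ge_zero)
        finally have "norm (X z) ^ m * norm (Y z) ^ k * norm (pair (one_minus_mpow z M) (K m k) $ p $ r)
            \<le> h ^ m * h ^ k * (B * (C * q ^ (m + k)) * c)"
          using zz h0 by (intro mult_mono power_mono) auto
        then show ?thesis
          by (simp add: \<phi>_eq[OF zz(3)] norm_mult norm_power power_mult_distrib power_add mult_ac)
      qed
      moreover have "(\<lambda>(m, k). B * C * c * (q * h) ^ (m + k)) summable_on UNIV"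
        using q h0 by (intro summable_on_geometric_pairs) auto
      ultimately show ?thesis
        using \<delta>(1) by (intro exI[of _ \<delta>] exI[of _ "\<lambda>(m, k). B * C * c * (q * h) ^ (m + k)"]) auto
    qed
    have \<phi>_hol: "\<phi> i holomorphic_on ?U" for i
      using \<phi>_pow[of "fst i" "snd i"] by (auto intro: holomorphic_on_subset simp: crescent_def)
    note sum_hol = infsum_holomorphic[where \<phi> = \<phi>, OF open_crescent \<phi>_hol dom]
    have hol: "L p r holomorphic_on ?U"
      using sum_hol(1) L_eq by (subst holomorphic_cong[OF refl, of _ "L p r" "\<lambda>s. \<Sum>\<^sub>\<infinity>i. \<phi> i s"]) auto
    have zero: "0 \<in> ?U" using \<alpha> \<beta> by (intro zero_in_crescent) auto
    have "(deriv ^^ n) (L p r) 0 = fact n * a p r n" for n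
    proof -
      have "eventually (\<lambda>s. L p r s = (\<Sum>\<^sub>\<infinity>i. \<phi> i s)) (nhds 0)"
        using eventually_nhds_in_open[OF open_crescent zero] by eventually_elim (rule L_eq)
      then have "(deriv ^^ n) (L p r) 0 = (deriv ^^ n) (\<lambda>s. \<Sum>\<^sub>\<infinity>i. \<phi> i s) 0"
        by (intro higher_deriv_cong_ev refl)
      also have "\<dots> = H n $ p $ r"
      proof (rule has_sum_unique)
        show "((\<lambda>i. (deriv ^^ n) (\<phi> i) 0) has_sum (deriv ^^ n) (\<lambda>s. \<Sum>\<^sub>\<infinity>i. \<phi> i s) 0) UNIV"
          by (rule sum_hol(2)[OF _ zero])
        show "((\<lambda>i. (deriv ^^ n) (\<phi> i) 0) has_sum H n $ p $ r) UNIV"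
          using has_sum_bounded_linear[OF entry_bounded_linear H[of n], of p r]
          by (rule has_sum_cong[THEN iffD1, rotated]) (auto simp: \<phi>_pow)
      qed
      finally show ?thesis by (simp add: a_def)
    qed
    with hol show ?thesis by blast
  qed
  have entry: "((t ^ n / fact n) *\<^sub>m H n) $ p $ r = a p r n * t ^ n" for n p r
    by (simp add: a_def)
  have "a p r n * t ^ n = a p r n * t ^ n" for p r n ..
  note taylor = taylor_series_on_crescent[OF conjunct1[OF L] \<alpha> \<beta> t spec[OF conjunct2[OF L]]]
  show "(\<lambda>n. (t ^ n / fact n) *\<^sub>m H n) sums pair (one_minus_mpow t M) (G (X t) (Y t))"
    if "summable (\<lambda>n. (t ^ n / fact n) *\<^sub>m H n)"
    using that taylor(1) unfolding summable_entrywise sums_entrywise entry by (simp add: L_def)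
  show "summable (\<lambda>n. (t ^ n / fact n) *\<^sub>m H n)" if "\<alpha> + norm t < 1" "\<beta> * (1 + norm t) < 1"
    using taylor(2)[OF that] unfolding summable_entrywise entry by simp
qed

text \<open>The instance for Horn functions.  What is specific to the four formulae is isolated in \<open>XY\<close>, which
  determines the exponent \<open>e\<close> from the substitution, and in \<open>coeff\<close>, which is an identity between
  Pochhammer symbols.\<close>
lemma horn_generating_function:
  fixes A A' B B' M :: "complex^'d^'d" and C C' D D' :: "nat \<Rightarrow> complex^'d^'d"
  assumes def: "mpoch_neg_defined B" "mpoch_neg_defined B'"
    and shifted_def: "\<And>n. mpoch_neg_defined (D n)" "\<And>n. mpoch_neg_defined (D' n)"
    and xy: "norm x < 1" "norm y < 1"
    and \<alpha>: "0 \<le> \<alpha>" "\<alpha> < 1" and \<beta>: "0 \<le> \<beta>" "\<beta> < 1"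
    and X: "continuous_on (crescent 1 \<alpha> \<beta>) X" "\<forall>s\<in>crescent 1 \<alpha> \<beta>. norm (X s) < 1"
    and Y: "continuous_on (crescent 1 \<alpha> \<beta>) Y" "\<forall>s\<in>crescent 1 \<alpha> \<beta>. norm (Y s) < 1"
    and XY: "\<forall>s\<in>crescent 1 \<alpha> \<beta>. \<forall>m k. X s ^ m * Y s ^ k = x ^ m * y ^ k * (1 - s) powi (- e m k)"
    and coeff: "\<And>n m k. pair (mpoch M n) (horn_coeff (C n) (C' n) (D n) (D' n) m k)
        = pair (mpoch (M + mat (of_int (e m k))) n) (horn_coeff A A' B B' m k)"
    and t: "t \<in> crescent 1 \<alpha> \<beta>"
  defines "f \<equiv> \<lambda>n. (t ^ n / fact n) *\<^sub>m pair (mpoch M n) (horn_G2 (C n) (C' n) (D n) (D' n) x y)"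
  shows "(summable f \<longrightarrow> pair (one_minus_mpow t M) (horn_G2 A A' B B' (X t) (Y t)) = (\<Sum>n. f n)) \<and>
    (\<alpha> + norm t < 1 \<and> \<beta> * (1 + norm t) < 1 \<longrightarrow> summable f)"
proof -
  have H: "((\<lambda>(m, k). (x ^ m * y ^ k) *\<^sub>m pair (mpoch (M + mat (of_int (e m k))) n) (horn_coeff A A' B B' m k))
      has_sum pair (mpoch M n) (horn_G2 (C n) (C' n) (D n) (D' n) x y)) UNIV" for n
    using has_sum_bounded_linear[OF bounded_linear_right
        horn_G2_has_sum[OF shifted_def xy, of "C n" "C' n" n n], of "mpoch M n"]
    by (simp add: case_prod_unfold cscale_right coeff)
  note gf = binomial_generating_function[OF horn_coeff_bound[OF def] \<alpha> \<beta>
      X(1) X(2)[rule_format] Y(1) Y(2)[rule_format] XY[rule_format] H t,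
      folded horn_G2_eq_coeff]
  from gf show ?thesis unfolding f_def by (auto simp: sums_iff)
qed

end

section \<open>The summation formulae\<close>

interpretation left_mult: complex_matrix_pairing "(**)"
  by (intro complex_matrix_pairing.intro complex_matrix_pairing_axioms.intro
      bounded_bilinear_matrix_matrix_mult cscale_matrix_mult_left cscale_matrix_mult_right)

interpretation right_mult: complex_matrix_pairing "\<lambda>P Q. Q ** P"
  by (intro complex_matrix_pairing.intro complex_matrix_pairing_axioms.intro
      bounded_bilinear.flip[OF bounded_bilinear_matrix_matrix_mult]
      cscale_matrix_mult_left cscale_matrix_mult_right)

text \<open>Both sides are \<open>mpoch M (n + k)\<close>.\<close>
lemma mpoch_shift_commute:
  "mpoch M n ** mpoch (M + mat (of_nat n)) k = mpoch (M + mat (of_nat k)) n ** mpoch M k"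
proof -
  have "mpoch (M + mat (of_nat k)) n ** mpoch M k = mpoch M k ** mpoch (M + mat (of_nat k)) n"
    by (intro commute_mpoch commute_shift commute_mpoch[OF refl, symmetric])
  then show ?thesis by (metis add.commute mpoch_add)
qed

text \<open>Both sides are \<open>mpoch_int M (j + n)\<close>.\<close>
lemma mpoch_int_shift_commute:
  assumes "\<And>n::nat. mpoch_neg_defined (M + mat (of_nat n) :: complex^'d^'d)"
  shows "mpoch_int (M + mat (of_nat n)) j ** mpoch M n = mpoch_int M j ** mpoch (M + mat (of_int j)) n"
proof -
  have "mpoch_neg_defined M" using assms[of 0] by (simp add: mat_zero)
  then show ?thesis by (simp add: mpoch_int_shift[OF assms] mpoch_int_add_nat)
qed

theorem theorem5p2:
  fixes A A' B B' :: "complex^'d^'d" and x y t :: complex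
  assumes "norm t < 1" and "norm x < 1" and "norm y < 1"
  shows
   "(mpoch_neg_defined B \<and> mpoch_neg_defined B' \<and> norm (x / (1 - t)) < 1 \<longrightarrow>
      (let f = (\<lambda>n. (t ^ n / fact n) *\<^sub>m (mpoch A n ** horn_G2 (A + mat (of_nat n)) A' B B' x y))
       in (summable f \<longrightarrow>
             one_minus_mpow t A ** horn_G2 A A' B B' (x / (1 - t)) y = (\<Sum>n. f n)) \<and>
          (norm x + norm t < 1 \<longrightarrow> summable f))) \<and>
    (mpoch_neg_defined B \<and> mpoch_neg_defined B' \<and> norm (y / (1 - t)) < 1 \<and>
     A ** A' = A' ** A \<longrightarrow>
      (let f = (\<lambda>n. (t ^ n / fact n) *\<^sub>m (mpoch A' n ** horn_G2 A (A' + mat (of_nat n)) B B' x y))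
       in (summable f \<longrightarrow>
             one_minus_mpow t A' ** horn_G2 A A' B B' x (y / (1 - t)) = (\<Sum>n. f n)) \<and>
          (norm y + norm t < 1 \<longrightarrow> summable f))) \<and>
    ((\<forall>n::nat. mpoch_neg_defined (B + mat (of_nat n))) \<and> mpoch_neg_defined B' \<and>
     norm (x * (1 - t)) < 1 \<and> norm (y / (1 - t)) < 1 \<and> B ** B' = B' ** B \<longrightarrow>
      (let f = (\<lambda>n. (t ^ n / fact n) *\<^sub>m (horn_G2 A A' (B + mat (of_nat n)) B' x y ** mpoch B n))
       in (summable f \<longrightarrow>
             horn_G2 A A' B B' (x * (1 - t)) (y / (1 - t)) ** one_minus_mpow t B = (\<Sum>n. f n)) \<and>
          (norm x * (1 + norm t) < 1 \<and> norm y + norm t < 1 \<longrightarrow> summable f))) \<and>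
    (mpoch_neg_defined B \<and> (\<forall>n::nat. mpoch_neg_defined (B' + mat (of_nat n))) \<and>
     norm (x / (1 - t)) < 1 \<and> norm (y * (1 - t)) < 1 \<longrightarrow>
      (let f = (\<lambda>n. (t ^ n / fact n) *\<^sub>m (horn_G2 A A' B (B' + mat (of_nat n)) x y ** mpoch B' n))
       in (summable f \<longrightarrow>
             horn_G2 A A' B B' (x / (1 - t)) (y * (1 - t)) ** one_minus_mpow t B' = (\<Sum>n. f n)) \<and>
          (norm x + norm t < 1 \<and> norm y * (1 + norm t) < 1 \<longrightarrow> summable f)))"
proof (intro conjI impI; elim conjE)
  have nz: "1 - s \<noteq> 0" if "s \<in> crescent 1 \<alpha> \<beta>" for s \<alpha> \<beta>
    using that by (auto simp: crescent_def)
  have quot: "\<forall>s\<in>crescent 1 (norm z) \<beta>. norm (z / (1 - s)) < 1" for z \<beta>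
    using nz by (auto simp: crescent_def norm_divide divide_less_eq)
  have prod: "\<forall>s\<in>crescent 1 \<alpha> (norm z). norm (z * (1 - s)) < 1" for z \<alpha>
    by (simp add: crescent_def norm_mult)
  have const: "\<forall>s\<in>crescent 1 \<alpha> \<beta>. norm z < 1" if "norm z < 1" for z :: complex and \<alpha> \<beta>
    using that by simp
  have quot_in: "norm z < norm (1 - t)" if "norm (z / (1 - t)) < 1" for z
    using that assms(1) by (cases "t = 1") (auto simp: norm_divide)
  have quot_cont: "continuous_on (crescent 1 \<alpha> \<beta>) (\<lambda>s. z / (1 - s))" for \<alpha> \<beta> z
    by (intro continuous_intros) (use nz in auto)
  have prod_cont: "continuous_on (crescent 1 \<alpha> \<beta>) (\<lambda>s. z * (1 - s))" for \<alpha> \<beta> and z :: complex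
    by (intro continuous_intros)
  {
    assume def: "mpoch_neg_defined B" "mpoch_neg_defined B'" and *: "norm (x / (1 - t)) < 1"
    have coeff: "mpoch A n ** horn_coeff (A + mat (of_nat n)) A' B B' m k
        = mpoch (A + mat (of_int (int m))) n ** horn_coeff A A' B B' m k" for n m k
      unfolding horn_coeff_def cscale_matrix_mult_right matrix_mul_assoc mpoch_shift_commute by simp
    have t: "t \<in> crescent 1 (norm x) 0"
      using quot_in[OF *] assms by (simp add: crescent_def)
    have XY: "\<forall>s\<in>crescent 1 (norm x) 0. \<forall>m k.
        (x / (1 - s)) ^ m * y ^ k = x ^ m * y ^ k * (1 - s) powi (- int m)"
      by (simp add: power_int_minus divide_inverse power_mult_distrib power_inverse)
    from left_mult.horn_generating_function[where D = "\<lambda>_. B" and D' = "\<lambda>_. B'"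
        and C = "\<lambda>n. A + mat (of_nat n)" and C' = "\<lambda>_. A'" and e = "\<lambda>m k. int m"
        and X = "\<lambda>s. x / (1 - s)" and Y = "\<lambda>s. y",
        OF def def assms(2,3) norm_ge_zero assms(2) order_refl zero_less_one
          quot_cont quot continuous_on_const const[OF assms(3)] XY coeff t]
    show "let f = \<lambda>n. (t ^ n / fact n) *\<^sub>m (mpoch A n ** horn_G2 (A + mat (of_nat n)) A' B B' x y)
      in (summable f \<longrightarrow> one_minus_mpow t A ** horn_G2 A A' B B' (x / (1 - t)) y = (\<Sum>n. f n)) \<and>
         (norm x + norm t < 1 \<longrightarrow> summable f)"
      unfolding Let_def by simp
  next
    assume def: "mpoch_neg_defined B" "mpoch_neg_defined B'" and *: "norm (y / (1 - t)) < 1"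
      and comm: "A ** A' = A' ** A"
    \<comment> \<open>Commuting \<open>A\<close> and \<open>A'\<close> lets \<open>mpoch A' n\<close> pass \<open>mpoch A m\<close> to reach the shifted symbol of \<open>A'\<close>.\<close>
    have coeff: "mpoch A' n ** horn_coeff A (A' + mat (of_nat n)) B B' m k
        = mpoch (A' + mat (of_int (int k))) n ** horn_coeff A A' B B' m k" for n m k
    proof -
      have "mpoch N j ** mpoch A m = mpoch A m ** mpoch N j" if "N ** A = A ** N" for N j
        using commute_mpoch[OF commute_mpoch[OF that, symmetric]] by simp
      then have c: "mpoch (A' + mat z) n ** mpoch A m = mpoch A m ** mpoch (A' + mat z) n"
          "mpoch A' n ** mpoch A m = mpoch A m ** mpoch A' n" for z
        using comm by (metis commute_shift)+
      have "mpoch A' n ** (mpoch A m ** mpoch (A' + mat (of_nat n)) k)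
          = mpoch (A' + mat (of_int (int k))) n ** (mpoch A m ** mpoch A' k)"
        by (simp add: c matrix_mul_assoc) (simp add: mpoch_shift_commute flip: matrix_mul_assoc)
      then show ?thesis
        unfolding horn_coeff_def cscale_matrix_mult_right by (simp add: matrix_mul_assoc)
    qed
    have t: "t \<in> crescent 1 (norm y) 0"
      using quot_in[OF *] assms by (simp add: crescent_def)
    have XY: "\<forall>s\<in>crescent 1 (norm y) 0. \<forall>m k.
        x ^ m * (y / (1 - s)) ^ k = x ^ m * y ^ k * (1 - s) powi (- int k)"
      by (simp add: power_int_minus divide_inverse power_mult_distrib power_inverse)
    from left_mult.horn_generating_function[where D = "\<lambda>_. B" and D' = "\<lambda>_. B'"
        and C = "\<lambda>_. A" and C' = "\<lambda>n. A' + mat (of_nat n)" and e = "\<lambda>m k. int k"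
        and X = "\<lambda>s. x" and Y = "\<lambda>s. y / (1 - s)",
        OF def def assms(2,3) norm_ge_zero assms(3) order_refl zero_less_one
          continuous_on_const const[OF assms(2)] quot_cont quot XY coeff t]
    show "let f = \<lambda>n. (t ^ n / fact n) *\<^sub>m (mpoch A' n ** horn_G2 A (A' + mat (of_nat n)) B B' x y)
      in (summable f \<longrightarrow> one_minus_mpow t A' ** horn_G2 A A' B B' x (y / (1 - t)) = (\<Sum>n. f n)) \<and>
         (norm y + norm t < 1 \<longrightarrow> summable f)"
      unfolding Let_def by simp
  next
    assume shifted: "\<forall>n::nat. mpoch_neg_defined (B + mat (of_nat n))" and def': "mpoch_neg_defined B'"
      and *: "norm (x * (1 - t)) < 1" "norm (y / (1 - t)) < 1" and comm: "B ** B' = B' ** B"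
    have def: "mpoch_neg_defined B" using shifted[rule_format, of 0] by (simp add: mat_zero)
    \<comment> \<open>Commuting \<open>B\<close> and \<open>B'\<close> lets \<open>mpoch B n\<close> pass the symbol of \<open>B'\<close> to reach the shifted symbol of \<open>B\<close>.\<close>
    have coeff: "horn_coeff A A' (B + mat (of_nat n)) B' m k ** mpoch B n
        = horn_coeff A A' B B' m k ** mpoch (B + mat (of_int (int k - int m))) n" for n m k
    proof -
      let ?b' = "mpoch_int B' (int m - int k)"
      have c: "?b' ** mpoch (B + mat z) n = mpoch (B + mat z) n ** ?b'" for z
        by (rule commute_mpoch_int[OF _ def'])
           (rule commute_mpoch[OF commute_shift[OF comm], symmetric])
      have "mpoch_int (B + mat (of_nat n)) (int k - int m) ** ?b' ** mpoch B n
          = mpoch_int (B + mat (of_nat n)) (int k - int m) ** mpoch B n ** ?b'"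
        using c[of 0] by (simp add: mat_zero flip: matrix_mul_assoc)
      also have "\<dots> = mpoch_int B (int k - int m) ** (mpoch (B + mat (of_int (int k - int m))) n ** ?b')"
        using shifted mpoch_int_shift_commute[of B n] by (simp only: matrix_mul_assoc simp_thms)
      also have "\<dots> = mpoch_int B (int k - int m) ** ?b' ** mpoch (B + mat (of_int (int k - int m))) n"
        by (simp only: c[symmetric] matrix_mul_assoc)
      finally show ?thesis
        unfolding horn_coeff_def cscale_matrix_mult_left by (simp flip: matrix_mul_assoc)
    qed
    have t: "t \<in> crescent 1 (norm y) (norm x)"
      using quot_in[OF *(2)] * assms by (simp add: crescent_def norm_mult)
    have XY: "\<forall>s\<in>crescent 1 (norm y) (norm x). \<forall>m k.
        (x * (1 - s)) ^ m * (y / (1 - s)) ^ k = x ^ m * y ^ k * (1 - s) powi (- (int k - int m))"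
      using nz by (simp add: power_mult_distrib power_divide power_int_diff)
    from right_mult.horn_generating_function[where D = "\<lambda>n. B + mat (of_nat n)" and D' = "\<lambda>_. B'"
        and C = "\<lambda>_. A" and C' = "\<lambda>_. A'" and e = "\<lambda>m k. int k - int m"
        and X = "\<lambda>s. x * (1 - s)" and Y = "\<lambda>s. y / (1 - s)",
        OF def def' shifted[rule_format] def' assms(2,3) norm_ge_zero assms(3) norm_ge_zero assms(2)
          prod_cont prod quot_cont quot XY coeff t]
    show "let f = \<lambda>n. (t ^ n / fact n) *\<^sub>m (horn_G2 A A' (B + mat (of_nat n)) B' x y ** mpoch B n)
      in (summable f \<longrightarrow>
            horn_G2 A A' B B' (x * (1 - t)) (y / (1 - t)) ** one_minus_mpow t B = (\<Sum>n. f n)) \<and>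
         (norm x * (1 + norm t) < 1 \<and> norm y + norm t < 1 \<longrightarrow> summable f)"
      unfolding Let_def by simp
  next
    assume def: "mpoch_neg_defined B" and shifted: "\<forall>n::nat. mpoch_neg_defined (B' + mat (of_nat n))"
      and *: "norm (x / (1 - t)) < 1" "norm (y * (1 - t)) < 1"
    have def': "mpoch_neg_defined B'" using shifted[rule_format, of 0] by (simp add: mat_zero)
    have coeff: "horn_coeff A A' B (B' + mat (of_nat n)) m k ** mpoch B' n
        = horn_coeff A A' B B' m k ** mpoch (B' + mat (of_int (int m - int k))) n" for n m k
      using mpoch_int_shift_commute[OF shifted[rule_format], of n "int m - int k"]
      unfolding horn_coeff_def cscale_matrix_mult_left by (simp flip: matrix_mul_assoc)
    have t: "t \<in> crescent 1 (norm x) (norm y)"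
      using quot_in[OF *(1)] * assms by (simp add: crescent_def norm_mult)
    have XY: "\<forall>s\<in>crescent 1 (norm x) (norm y). \<forall>m k.
        (x / (1 - s)) ^ m * (y * (1 - s)) ^ k = x ^ m * y ^ k * (1 - s) powi (- (int m - int k))"
      using nz by (simp add: power_mult_distrib power_divide power_int_diff)
    from right_mult.horn_generating_function[where D = "\<lambda>_. B" and D' = "\<lambda>n. B' + mat (of_nat n)"
        and C = "\<lambda>_. A" and C' = "\<lambda>_. A'" and e = "\<lambda>m k. int m - int k"
        and X = "\<lambda>s. x / (1 - s)" and Y = "\<lambda>s. y * (1 - s)",
        OF def def' def shifted[rule_format] assms(2,3) norm_ge_zero assms(2) norm_ge_zero assms(3)
          quot_cont quot prod_cont prod XY coeff t]
    show "let f = \<lambda>n. (t ^ n / fact n) *\<^sub>m (horn_G2 A A' B (B' + mat (of_nat n)) x y ** mpoch B' n)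
      in (summable f \<longrightarrow>
            horn_G2 A A' B B' (x / (1 - t)) (y * (1 - t)) ** one_minus_mpow t B' = (\<Sum>n. f n)) \<and>
         (norm x + norm t < 1 \<and> norm y * (1 + norm t) < 1 \<longrightarrow> summable f)"
      unfolding Let_def by simp
  }
qed

end
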